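(* Let $k$ be a field of characteristic zero and $A := k[Y]$ the polynomial Hopf algebra. Then: (1) Up to an isomorphism of Hopf algebras there exist exactly two crossed products of Hopf algebras $A \# H_4$: $A \otimes H_4$ and $A_{(\infty)}$, where $A_{(\infty)}$ denotes the infinite dimensional Hopf algebra generated by $g$ and $x$ subject to the relations $$g^2 = 1, \quad x g = - g x$$ and with the coalgebra structure given such that $g$ is a group-like element and $x$ is $(1, g)$-primitive. Furthermore, there are isomorphisms of groups $$\mathrm{Aut}_{\rm Hopf} \big( A \otimes H_{4} \big) \simeq k^* \times k^* \qquad \text{and} \qquad \mathrm{Aut}_{\rm Hopf} \big( A_{(\infty)} \big) \simeq k^*.$$ (2) There exists a bijection $\mathcal{H}^{2}(H_4, A) \cong k$.
   Context: The polynomial Hopf algebra $k[Y]$ has $Y$ primitive: $\Delta(Y)=Y\otimes1+1\otimes Y$. Group-like means $\Delta(g)=g\otimes g$; $x$ is $(1,g)$-primitive means $\Delta(x)=x\otimes 1+g\otimes x$. $\mathrm{Aut}_{\rm Hopf}$ denotes the group of Hopf algebra automorphisms. $H_4$ is Sweedler's 4-dimensional Hopf algebra over $k$, with basis $\{1,g,x,gx\}$, relations $g^2=1$, $x^2=0$, $xg=-gx$, $g$ group-like and $x$ $(1,g)$-primitive. Sweedler notation is used. For Hopf algebras $A$, $H$, a weak action of $H$ on $A$ is a $k$-linear map $\triangleright: H\otimes A\to A$ with $h\triangleright 1_A=\varepsilon_H(h)1_A$, $1_H\triangleright a=a$, and $h\triangleright(ab)=(h_{(1)}\triangleright a)(h_{(2)}\triangleright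 b)$. Given a weak action $\triangleright$ and a $k$-linear map $f:H\otimes H\to A$ (write $f(g,h)=f(g\otimes h)$), $A\#_f^{\triangleright}H$ denotes the vector space $A\otimes H$ (write $a\#h$ for $a\otimes h$) with multiplication $(a\#h)\cdot(c\#g):=a(h_{(1)}\triangleright c)f(h_{(2)},g_{(1)})\#h_{(3)}g_{(2)}$. $(A,H,\triangleright,f)$ is a crossed system of Hopf algebras, and $A\#_f^{\triangleright}H$ (also written $A\#H$) a crossed product of Hopf algebras, if $A\#_f^{\triangleright}H$ is a Hopf algebra with this multiplication, unit $1_A\#1_H$ and the tensor product coalgebra structure. Let $\mathcal{CS}(A,H)$ be the set of pairs $(\triangleright,f)$ such that $(A,H,\triangleright,f)$ is a crossed system of Hopf algebras. Put $(\triangleright,f)\approx(\triangleright',f')$ if there is a unitary cocentral map $r:H\to A$ (a coalgebra map with $r(1)=1$ and $r(h_{(1)})\otimes h_{(2)}=r(h_{(2)})\otimes h_{(1)}$ for all $h$) such that $h\triangleright' a=r(h_{(1)})(h_{(2)}\triangleright a)(S_A\circ r)(h_{(3)})$ and $f'(h,g)=r(h_{(1)})\bigl(h_{(2)}\triangleright r(g_{(1)})\bigr)f(h_{(3)},g_{(2)})(S_A\circ r)(h_{(4)}g_{(3)})$ for all $a\in A$, $h,g\in H$. This is an equivalence relation, and $\mathcal{H}^2(H,A):=\mathcal{CS}(A,H)/\approx$. *)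

theory Defs
  imports
    Complex_Main
    "HOL-Library.Poly_Mapping"
    "HOL-Library.Product_Plus"
    "HOL-Algebra.Group"
begin

section \<open>Vector spaces and tensor products\<close>

text \<open>
  A vector space over the field \<open>'k\<close> is given with a basis: the finitely supported functions
  \<open>'b \<Rightarrow>\<^sub>0 'k\<close> are the vector space with basis indexed by \<open>'b\<close>, and the tensor product of
  \<open>'b \<Rightarrow>\<^sub>0 'k\<close> and \<open>'c \<Rightarrow>\<^sub>0 'k\<close> is \<open>'b \<times> 'c \<Rightarrow>\<^sub>0 'k\<close>.
\<close>

definition smul :: "'k::field \<Rightarrow> ('b \<Rightarrow>\<^sub>0 'k) \<Rightarrow> ('b \<Rightarrow>\<^sub>0 'k)" where
  "smul c v = Poly_Mapping.map ((*) c) v"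

lemma lookup_smul [simp]: "Poly_Mapping.lookup (smul c v) i = c * Poly_Mapping.lookup v i"
  by (simp add: smul_def Poly_Mapping.map.rep_eq when_def)

interpretation fs: vector_space "smul :: 'k::field \<Rightarrow> ('b \<Rightarrow>\<^sub>0 'k) \<Rightarrow> ('b \<Rightarrow>\<^sub>0 'k)"
  by unfold_locales (auto intro!: poly_mapping_eqI simp: lookup_add algebra_simps)

abbreviation klinear :: "(('b \<Rightarrow>\<^sub>0 'k::field) \<Rightarrow> ('c \<Rightarrow>\<^sub>0 'k)) \<Rightarrow> bool" where
  "klinear \<equiv> Vector_Spaces.linear smul smul"

abbreviation bvec :: "'b \<Rightarrow> ('b \<Rightarrow>\<^sub>0 'k::field)" where
  "bvec i \<equiv> Poly_Mapping.single i 1"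

definition lin_ext :: "('b \<Rightarrow> ('c \<Rightarrow>\<^sub>0 'k::field)) \<Rightarrow> ('b \<Rightarrow>\<^sub>0 'k) \<Rightarrow> ('c \<Rightarrow>\<^sub>0 'k)" where
  "lin_ext F v = (\<Sum>i\<in>Poly_Mapping.keys v. smul (Poly_Mapping.lookup v i) (F i))"

definition tens :: "('b \<Rightarrow>\<^sub>0 'k::field) \<Rightarrow> ('c \<Rightarrow>\<^sub>0 'k) \<Rightarrow> ('b \<times> 'c \<Rightarrow>\<^sub>0 'k)"
    (infixr \<open>\<otimes>\<^sub>k\<close> 75) where
  "v \<otimes>\<^sub>k w = lin_ext (\<lambda>i. lin_ext (\<lambda>j. bvec (i, j)) w) v"

text \<open>The linear map on a tensor product that is induced by a bilinear map \<open>F\<close>.\<close>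

definition tlift ::
  "(('b \<Rightarrow>\<^sub>0 'k::field) \<Rightarrow> ('c \<Rightarrow>\<^sub>0 'k) \<Rightarrow> ('d \<Rightarrow>\<^sub>0 'k)) \<Rightarrow> ('b \<times> 'c \<Rightarrow>\<^sub>0 'k) \<Rightarrow> ('d \<Rightarrow>\<^sub>0 'k)" where
  "tlift F = lin_ext (\<lambda>(i, j). F (bvec i) (bvec j))"


section \<open>Algebras, coalgebras and Hopf algebras\<close>

record (overloaded) ('b, 'k::zero) algebra_str =
  amult :: "('b \<Rightarrow>\<^sub>0 'k) \<Rightarrow> ('b \<Rightarrow>\<^sub>0 'k) \<Rightarrow> ('b \<Rightarrow>\<^sub>0 'k)"
  aone :: "'b \<Rightarrow>\<^sub>0 'k"

record (overloaded) ('b, 'k::zero) hopf_str = "('b, 'k) algebra_str" +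
  comult :: "('b \<Rightarrow>\<^sub>0 'k) \<Rightarrow> ('b \<times> 'b \<Rightarrow>\<^sub>0 'k)"
  counit :: "('b \<Rightarrow>\<^sub>0 'k) \<Rightarrow> 'k"

text \<open>
  Sweedler notation: \<open>sw2 L h F\<close> is \<open>F h\<^sub>1 h\<^sub>2\<close>, for \<open>F\<close> linear in each argument; similarly
  for iterated comultiplications.
\<close>

definition sw2 :: "('b, 'k::field) hopf_str \<Rightarrow> ('b \<Rightarrow>\<^sub>0 'k) \<Rightarrow>
    (('b \<Rightarrow>\<^sub>0 'k) \<Rightarrow> ('b \<Rightarrow>\<^sub>0 'k) \<Rightarrow> ('c \<Rightarrow>\<^sub>0 'k)) \<Rightarrow> ('c \<Rightarrow>\<^sub>0 'k)" where
  "sw2 L h F = tlift F (comult L h)"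

definition sw3 :: "('b, 'k::field) hopf_str \<Rightarrow> ('b \<Rightarrow>\<^sub>0 'k) \<Rightarrow>
    (('b \<Rightarrow>\<^sub>0 'k) \<Rightarrow> ('b \<Rightarrow>\<^sub>0 'k) \<Rightarrow> ('b \<Rightarrow>\<^sub>0 'k) \<Rightarrow> ('c \<Rightarrow>\<^sub>0 'k)) \<Rightarrow> ('c \<Rightarrow>\<^sub>0 'k)" where
  "sw3 L h F = sw2 L h (\<lambda>h1 h'. sw2 L h' (\<lambda>h2 h3. F h1 h2 h3))"

definition sw4 :: "('b, 'k::field) hopf_str \<Rightarrow> ('b \<Rightarrow>\<^sub>0 'k) \<Rightarrow>
    (('b \<Rightarrow>\<^sub>0 'k) \<Rightarrow> ('b \<Rightarrow>\<^sub>0 'k) \<Rightarrow> ('b \<Rightarrow>\<^sub>0 'k) \<Rightarrow> ('b \<Rightarrow>\<^sub>0 'k) \<Rightarrow> ('c \<Rightarrow>\<^sub>0 'k)) \<Rightarrow> ('c \<Rightarrow>\<^sub>0 'k)" where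
  "sw4 L h F = sw2 L h (\<lambda>h1 h'. sw3 L h' (\<lambda>h2 h3 h4. F h1 h2 h3 h4))"

definition is_algebra :: "('b, 'k::field, 'z) algebra_str_scheme \<Rightarrow> bool" where
  "is_algebra L \<longleftrightarrow>
     (\<forall>x. klinear (\<lambda>y. amult L x y)) \<and> (\<forall>y. klinear (\<lambda>x. amult L x y)) \<and>
     (\<forall>x y z. amult L (amult L x y) z = amult L x (amult L y z)) \<and>
     (\<forall>x. amult L (aone L) x = x \<and> amult L x (aone L) = x)"

definition is_coalgebra :: "('b, 'k::field) hopf_str \<Rightarrow> bool" where
  "is_coalgebra L \<longleftrightarrow>
     klinear (comult L) \<and> Vector_Spaces.linear smul (*) (counit L) \<and>
     (\<forall>h. sw2 L h (\<lambda>h' h3. sw2 L h' (\<lambda>h1 h2. h1 \<otimes>\<^sub>k h2 \<otimes>\<^sub>k h3)) =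
          sw2 L h (\<lambda>h1 h'. sw2 L h' (\<lambda>h2 h3. h1 \<otimes>\<^sub>k h2 \<otimes>\<^sub>k h3))) \<and>
     (\<forall>h. sw2 L h (\<lambda>h1 h2. smul (counit L h1) h2) = h) \<and>
     (\<forall>h. sw2 L h (\<lambda>h1 h2. smul (counit L h2) h1) = h)"

definition is_bialgebra :: "('b, 'k::field) hopf_str \<Rightarrow> bool" where
  "is_bialgebra L \<longleftrightarrow> is_algebra L \<and> is_coalgebra L \<and>
     (\<forall>x y. comult L (amult L x y) =
        sw2 L x (\<lambda>x1 x2. sw2 L y (\<lambda>y1 y2. amult L x1 y1 \<otimes>\<^sub>k amult L x2 y2))) \<and>
     comult L (aone L) = aone L \<otimes>\<^sub>k aone L \<and>
     (\<forall>x y. counit L (amult L x y) = counit L x * counit L y) \<and>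
     counit L (aone L) = 1"

definition is_antipode :: "('b, 'k::field) hopf_str \<Rightarrow> (('b \<Rightarrow>\<^sub>0 'k) \<Rightarrow> ('b \<Rightarrow>\<^sub>0 'k)) \<Rightarrow> bool" where
  "is_antipode L S \<longleftrightarrow> klinear S \<and>
     (\<forall>h. sw2 L h (\<lambda>h1 h2. amult L (S h1) h2) = smul (counit L h) (aone L)) \<and>
     (\<forall>h. sw2 L h (\<lambda>h1 h2. amult L h1 (S h2)) = smul (counit L h) (aone L))"

definition hopf_algebra :: "('b, 'k::field) hopf_str \<Rightarrow> bool" where
  "hopf_algebra L \<longleftrightarrow> is_bialgebra L \<and> (\<exists>S. is_antipode L S)"

definition antipode :: "('b, 'k::field) hopf_str \<Rightarrow> (('b \<Rightarrow>\<^sub>0 'k) \<Rightarrow> ('b \<Rightarrow>\<^sub>0 'k))" where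
  "antipode L = (THE S. is_antipode L S)"

definition group_like :: "('b, 'k::field) hopf_str \<Rightarrow> ('b \<Rightarrow>\<^sub>0 'k) \<Rightarrow> bool" where
  "group_like L g \<longleftrightarrow> g \<noteq> 0 \<and> comult L g = g \<otimes>\<^sub>k g"

text \<open>\<open>(1,g)\<close>-primitive elements, in the convention \<open>\<Delta>(x) = x \<otimes> 1 + g \<otimes> x\<close>.\<close>

definition skew_primitive :: "('b, 'k::field) hopf_str \<Rightarrow> ('b \<Rightarrow>\<^sub>0 'k) \<Rightarrow> ('b \<Rightarrow>\<^sub>0 'k) \<Rightarrow> bool" where
  "skew_primitive L g x \<longleftrightarrow> comult L x = x \<otimes>\<^sub>k aone L + g \<otimes>\<^sub>k x"

definition coalgebra_map ::
  "('b, 'k::field) hopf_str \<Rightarrow> ('c, 'k) hopf_str \<Rightarrow> (('b \<Rightarrow>\<^sub>0 'k) \<Rightarrow> ('c \<Rightarrow>\<^sub>0 'k)) \<Rightarrow> bool" where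
  "coalgebra_map L M \<phi> \<longleftrightarrow> klinear \<phi> \<and>
     (\<forall>h. comult M (\<phi> h) = sw2 L h (\<lambda>h1 h2. \<phi> h1 \<otimes>\<^sub>k \<phi> h2)) \<and>
     (\<forall>h. counit M (\<phi> h) = counit L h)"

definition hopf_iso ::
  "('b, 'k::field) hopf_str \<Rightarrow> ('c, 'k) hopf_str \<Rightarrow> (('b \<Rightarrow>\<^sub>0 'k) \<Rightarrow> ('c \<Rightarrow>\<^sub>0 'k)) \<Rightarrow> bool" where
  "hopf_iso L M \<phi> \<longleftrightarrow> bij \<phi> \<and> coalgebra_map L M \<phi> \<and>
     (\<forall>x y. \<phi> (amult L x y) = amult M (\<phi> x) (\<phi> y)) \<and> \<phi> (aone L) = aone M"

definition hopf_isomorphic :: "('b, 'k::field) hopf_str \<Rightarrow> ('c, 'k) hopf_str \<Rightarrow> bool"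
    (infix \<open>\<cong>\<^sub>H\<close> 50) where
  "L \<cong>\<^sub>H M \<longleftrightarrow> (\<exists>\<phi>. hopf_iso L M \<phi>)"

definition Aut_Hopf :: "('b, 'k::field) hopf_str \<Rightarrow> (('b \<Rightarrow>\<^sub>0 'k) \<Rightarrow> ('b \<Rightarrow>\<^sub>0 'k)) monoid" where
  "Aut_Hopf L = \<lparr>carrier = {\<phi>. hopf_iso L L \<phi>}, monoid.mult = (\<circ>), one = id\<rparr>"

definition field_units :: "'k::field monoid" where
  "field_units = \<lparr>carrier = UNIV - {0}, monoid.mult = (*), one = 1\<rparr>"


section \<open>Tensor products and crossed products\<close>

definition tensor_comult :: "('a, 'k::field) hopf_str \<Rightarrow> ('h, 'k) hopf_str \<Rightarrow>
    ('a \<times> 'h \<Rightarrow>\<^sub>0 'k) \<Rightarrow> (('a \<times> 'h) \<times> ('a \<times> 'h) \<Rightarrow>\<^sub>0 'k)" where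
  "tensor_comult A H =
     tlift (\<lambda>a h. sw2 A a (\<lambda>a1 a2. sw2 H h (\<lambda>h1 h2. (a1 \<otimes>\<^sub>k h1) \<otimes>\<^sub>k (a2 \<otimes>\<^sub>k h2))))"

definition tensor_counit ::
  "('a, 'k::field) hopf_str \<Rightarrow> ('h, 'k) hopf_str \<Rightarrow> ('a \<times> 'h \<Rightarrow>\<^sub>0 'k) \<Rightarrow> 'k" where
  "tensor_counit A H t =
     (\<Sum>(i, j)\<in>Poly_Mapping.keys t.
        Poly_Mapping.lookup t (i, j) * (counit A (bvec i) * counit H (bvec j)))"

definition tensor_hopf ::
  "('a, 'k::field) hopf_str \<Rightarrow> ('h, 'k) hopf_str \<Rightarrow> ('a \<times> 'h, 'k) hopf_str" where
  "tensor_hopf A H =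
     \<lparr>amult = \<lambda>s t. tlift (\<lambda>a h. tlift (\<lambda>c g. amult A a c \<otimes>\<^sub>k amult H h g) t) s,
      aone = aone A \<otimes>\<^sub>k aone H,
      comult = tensor_comult A H,
      counit = tensor_counit A H\<rparr>"

definition weak_action :: "('a, 'k::field) hopf_str \<Rightarrow> ('h, 'k) hopf_str \<Rightarrow>
    (('h \<times> 'a \<Rightarrow>\<^sub>0 'k) \<Rightarrow> ('a \<Rightarrow>\<^sub>0 'k)) \<Rightarrow> bool" where
  "weak_action A H act \<longleftrightarrow> klinear act \<and>
     (\<forall>h. act (h \<otimes>\<^sub>k aone A) = smul (counit H h) (aone A)) \<and>
     (\<forall>a. act (aone H \<otimes>\<^sub>k a) = a) \<and>
     (\<forall>h a b. act (h \<otimes>\<^sub>k amult A a b) =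
        sw2 H h (\<lambda>h1 h2. amult A (act (h1 \<otimes>\<^sub>k a)) (act (h2 \<otimes>\<^sub>k b))))"

definition crossed_product :: "('a, 'k::field) hopf_str \<Rightarrow> ('h, 'k) hopf_str \<Rightarrow>
    (('h \<times> 'a \<Rightarrow>\<^sub>0 'k) \<Rightarrow> ('a \<Rightarrow>\<^sub>0 'k)) \<Rightarrow> (('h \<times> 'h \<Rightarrow>\<^sub>0 'k) \<Rightarrow> ('a \<Rightarrow>\<^sub>0 'k)) \<Rightarrow>
    ('a \<times> 'h, 'k) hopf_str" where
  "crossed_product A H act f =
     \<lparr>amult = \<lambda>s t. tlift (\<lambda>a h. tlift (\<lambda>c g.
         sw3 H h (\<lambda>h1 h2 h3. sw2 H g (\<lambda>g1 g2.
           amult A (amult A a (act (h1 \<otimes>\<^sub>k c))) (f (h2 \<otimes>\<^sub>k g1)) \<otimes>\<^sub>k amult H h3 g2))) t) s,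
      aone = aone A \<otimes>\<^sub>k aone H,
      comult = tensor_comult A H,
      counit = tensor_counit A H\<rparr>"

definition crossed_system :: "('a, 'k::field) hopf_str \<Rightarrow> ('h, 'k) hopf_str \<Rightarrow>
    (('h \<times> 'a \<Rightarrow>\<^sub>0 'k) \<Rightarrow> ('a \<Rightarrow>\<^sub>0 'k)) \<Rightarrow> (('h \<times> 'h \<Rightarrow>\<^sub>0 'k) \<Rightarrow> ('a \<Rightarrow>\<^sub>0 'k)) \<Rightarrow> bool" where
  "crossed_system A H act f \<longleftrightarrow>
     weak_action A H act \<and> klinear f \<and> hopf_algebra (crossed_product A H act f)"

definition CS :: "('a, 'k::field) hopf_str \<Rightarrow> ('h, 'k) hopf_str \<Rightarrow>
    ((('h \<times> 'a \<Rightarrow>\<^sub>0 'k) \<Rightarrow> ('a \<Rightarrow>\<^sub>0 'k)) \<times> (('h \<times> 'h \<Rightarrow>\<^sub>0 'k) \<Rightarrow> ('a \<Rightarrow>\<^sub>0 'k))) set" where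
  "CS A H = {(act, f). crossed_system A H act f}"

definition unitary_cocentral :: "('a, 'k::field) hopf_str \<Rightarrow> ('h, 'k) hopf_str \<Rightarrow>
    (('h \<Rightarrow>\<^sub>0 'k) \<Rightarrow> ('a \<Rightarrow>\<^sub>0 'k)) \<Rightarrow> bool" where
  "unitary_cocentral A H r \<longleftrightarrow> coalgebra_map H A r \<and> r (aone H) = aone A \<and>
     (\<forall>h. sw2 H h (\<lambda>h1 h2. r h1 \<otimes>\<^sub>k h2) = sw2 H h (\<lambda>h1 h2. r h2 \<otimes>\<^sub>k h1))"

definition CS_rel :: "('a, 'k::field) hopf_str \<Rightarrow> ('h, 'k) hopf_str \<Rightarrow>
    (((('h \<times> 'a \<Rightarrow>\<^sub>0 'k) \<Rightarrow> ('a \<Rightarrow>\<^sub>0 'k)) \<times> (('h \<times> 'h \<Rightarrow>\<^sub>0 'k) \<Rightarrow> ('a \<Rightarrow>\<^sub>0 'k))) \<times>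
     ((('h \<times> 'a \<Rightarrow>\<^sub>0 'k) \<Rightarrow> ('a \<Rightarrow>\<^sub>0 'k)) \<times> (('h \<times> 'h \<Rightarrow>\<^sub>0 'k) \<Rightarrow> ('a \<Rightarrow>\<^sub>0 'k)))) set" where
  "CS_rel A H = {((act, f), (act', f')).
     (act, f) \<in> CS A H \<and> (act', f') \<in> CS A H \<and>
     (\<exists>r. unitary_cocentral A H r \<and>
        (\<forall>h a. act' (h \<otimes>\<^sub>k a) = sw3 H h (\<lambda>h1 h2 h3.
           amult A (amult A (r h1) (act (h2 \<otimes>\<^sub>k a))) (antipode A (r h3)))) \<and>
        (\<forall>h g. f' (h \<otimes>\<^sub>k g) = sw4 H h (\<lambda>h1 h2 h3 h4. sw3 H g (\<lambda>g1 g2 g3.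
           amult A (amult A (amult A (r h1) (act (h2 \<otimes>\<^sub>k r g1))) (f (h3 \<otimes>\<^sub>k g2)))
             (antipode A (r (amult H h4 g3)))))))}"

text \<open>\<open>H2 H A\<close> is the set \<open>\<H>\<^sup>2(H, A)\<close> of equivalence classes.\<close>

definition H2 :: "('h, 'k::field) hopf_str \<Rightarrow> ('a, 'k) hopf_str \<Rightarrow>
    ((('h \<times> 'a \<Rightarrow>\<^sub>0 'k) \<Rightarrow> ('a \<Rightarrow>\<^sub>0 'k)) \<times> (('h \<times> 'h \<Rightarrow>\<^sub>0 'k) \<Rightarrow> ('a \<Rightarrow>\<^sub>0 'k))) set set" where
  "H2 H A = CS A H // CS_rel A H"


section \<open>Presentations by generators and relations\<close>

definition free_algebra :: "('x list, 'k::field) algebra_str" where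
  "free_algebra =
     \<lparr>amult = \<lambda>p q. lin_ext (\<lambda>u. lin_ext (\<lambda>v. bvec (u @ v)) q) p, aone = bvec []\<rparr>"

definition free_eval :: "('b, 'k::field, 'z) algebra_str_scheme \<Rightarrow> ('x \<Rightarrow> ('b \<Rightarrow>\<^sub>0 'k)) \<Rightarrow>
    ('x list \<Rightarrow>\<^sub>0 'k) \<Rightarrow> ('b \<Rightarrow>\<^sub>0 'k)" where
  "free_eval L \<phi> = lin_ext (\<lambda>u. foldr (\<lambda>s. amult L (\<phi> s)) u (aone L))"

definition two_sided_ideal ::
  "('b, 'k::field, 'z) algebra_str_scheme \<Rightarrow> ('b \<Rightarrow>\<^sub>0 'k) set \<Rightarrow> bool" where
  "two_sided_ideal L I \<longleftrightarrow> fs.subspace I \<and> (\<forall>p. \<forall>q\<in>I. amult L p q \<in> I \<and> amult L q p \<in> I)"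

definition ideal_gen ::
  "('b, 'k::field, 'z) algebra_str_scheme \<Rightarrow> ('b \<Rightarrow>\<^sub>0 'k) set \<Rightarrow> ('b \<Rightarrow>\<^sub>0 'k) set" where
  "ideal_gen L R = \<Inter>{I. two_sided_ideal L I \<and> R \<subseteq> I}"

text \<open>
  \<open>L\<close> is the algebra generated by the elements \<open>\<phi> s\<close> subject to the relations \<open>p = 0\<close>
  for \<open>p \<in> R\<close>, i.e. the canonical map from the free algebra induces an isomorphism
  of its quotient by the ideal generated by \<open>R\<close> onto \<open>L\<close>.
\<close>

definition presented_by :: "('b, 'k::field, 'z) algebra_str_scheme \<Rightarrow> ('x \<Rightarrow> ('b \<Rightarrow>\<^sub>0 'k)) \<Rightarrow>
    ('x list \<Rightarrow>\<^sub>0 'k) set \<Rightarrow> bool" where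
  "presented_by L \<phi> R \<longleftrightarrow> is_algebra L \<and> surj (free_eval L \<phi>) \<and>
     {p. free_eval L \<phi> p = 0} = ideal_gen free_algebra R"


section \<open>The Hopf algebras of the classification\<close>

text \<open>
  The polynomial algebra \<open>k[Y]\<close> is \<open>nat \<Rightarrow>\<^sub>0 'k\<close> with the library's product, where
  \<open>Y\<^sup>n\<close> is \<open>bvec n\<close>; likewise, the tensor product algebra \<open>k[Y] \<otimes> k[Y]\<close> is
  \<open>nat \<times> nat \<Rightarrow>\<^sub>0 'k\<close> with the library's product, and the power below is taken there.
\<close>

definition polyY :: "(nat, 'k::field) hopf_str" where
  "polyY =
     \<lparr>amult = (*),
      aone = 1,
      comult = lin_ext (\<lambda>n. (bvec 1 \<otimes>\<^sub>k 1 + 1 \<otimes>\<^sub>k bvec 1) ^ n),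
      counit = \<lambda>p. Poly_Mapping.lookup p 0\<rparr>"

datatype h4 = H4_1 | H4_g | H4_x | H4_gx

fun h4_mult :: "h4 \<Rightarrow> h4 \<Rightarrow> (h4 \<Rightarrow>\<^sub>0 'k::field)" where
  "h4_mult H4_1 b = bvec b"
| "h4_mult a H4_1 = bvec a"
| "h4_mult H4_g H4_g = bvec H4_1"
| "h4_mult H4_g H4_x = bvec H4_gx"
| "h4_mult H4_g H4_gx = bvec H4_x"
| "h4_mult H4_x H4_g = - bvec H4_gx"
| "h4_mult H4_x H4_x = 0"
| "h4_mult H4_x H4_gx = 0"
| "h4_mult H4_gx H4_g = - bvec H4_x"
| "h4_mult H4_gx H4_x = 0"
| "h4_mult H4_gx H4_gx = 0"

fun h4_comult :: "h4 \<Rightarrow> (h4 \<times> h4 \<Rightarrow>\<^sub>0 'k::field)" where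
  "h4_comult H4_1 = bvec H4_1 \<otimes>\<^sub>k bvec H4_1"
| "h4_comult H4_g = bvec H4_g \<otimes>\<^sub>k bvec H4_g"
| "h4_comult H4_x = bvec H4_x \<otimes>\<^sub>k bvec H4_1 + bvec H4_g \<otimes>\<^sub>k bvec H4_x"
| "h4_comult H4_gx = bvec H4_gx \<otimes>\<^sub>k bvec H4_g + bvec H4_1 \<otimes>\<^sub>k bvec H4_gx"

definition sweedlerH4 :: "(h4, 'k::field) hopf_str" where
  "sweedlerH4 =
     \<lparr>amult = \<lambda>p q. lin_ext (\<lambda>a. lin_ext (\<lambda>b. h4_mult a b) q) p,
      aone = bvec H4_1,
      comult = lin_ext h4_comult,
      counit = \<lambda>p. Poly_Mapping.lookup p H4_1 + Poly_Mapping.lookup p H4_g\<rparr>"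

datatype gen = gen_g | gen_x

text \<open>
  \<open>L\<close>, with the elements \<open>g\<close> and \<open>x\<close>, is the Hopf algebra \<open>A\<^sub>(\<^sub>\<infinity>\<^sub>)\<close> generated by \<open>g\<close> and \<open>x\<close>
  subject to \<open>g\<^sup>2 = 1\<close> and \<open>x g = - g x\<close>. These data determine \<open>L\<close> up to isomorphism.
\<close>

definition is_A_infinity ::
  "('b, 'k::field) hopf_str \<Rightarrow> ('b \<Rightarrow>\<^sub>0 'k) \<Rightarrow> ('b \<Rightarrow>\<^sub>0 'k) \<Rightarrow> bool" where
  "is_A_infinity L g x \<longleftrightarrow> hopf_algebra L \<and>
     presented_by L (\<lambda>s. case s of gen_g \<Rightarrow> g | gen_x \<Rightarrow> x)
       {bvec [gen_g, gen_g] - bvec [], bvec [gen_x, gen_g] + bvec [gen_g, gen_x]} \<and>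
     group_like L g \<and> skew_primitive L g x"

end

theory Submission
  imports Defs
begin

text \<open>
  Let \<open>M\<^sub>a\<close> (the constant \<open>model a\<close>) be the Hopf algebra with \<open>k[Y]\<close>-basis \<open>1, g, x, gx\<close>, relations
  \<open>g\<^sup>2 = 1\<close>, \<open>xg = - gx\<close>, \<open>x\<^sup>2 = aY\<close>, \<open>Y\<close> central, and the coalgebra structure of \<open>k[Y] \<otimes> H\<^sub>4\<close>. It is
  a Hopf algebra for every scalar \<open>a\<close>, because \<open>x\<^sup>2\<close> is primitive whenever \<open>x\<close> is
  \<open>(1,g)\<close>-primitive and anticommutes with \<open>g\<close> (lemma \<open>hopf_algebra_model\<close>). The theorem
  reduces to these Hopf algebras.

  The crossed products are exactly the \<open>M\<^sub>a\<close> (\<open>crossed_system_cases\<close>, \<open>CS_eq\<close>). Since the coalgebra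
  structure of a crossed product is the tensor product one, comparing coordinates in \<open>\<Delta>\<close> of a few
  products forces the action to be trivial and all values of the cocycle to be \<open>0\<close> or \<open>1\<close>, except
  those at two odd elements, which are \<open>aY\<close> or \<open>- aY\<close> because \<open>f(x,x)\<close> is a primitive polynomial. In
  characteristic zero the primitive polynomials are the multiples of \<open>Y\<close>, and the only group-like
  polynomial is \<open>1\<close>.

  The isomorphisms \<open>M\<^sub>a \<rightarrow> M\<^sub>a'\<close> are the rescalings \<open>Y \<mapsto> dY\<close>, \<open>x \<mapsto> bx\<close> with
  \<open>ad = b\<^sup>2a'\<close> (\<open>hopf_iso_rescale\<close>, \<open>hopf_iso_model_cases\<close>). This one equation shows that
  \<open>M\<^sub>a \<cong> M\<^sub>1\<close> for \<open>a \<noteq> 0\<close>, that \<open>M\<^sub>0 = k[Y] \<otimes> H\<^sub>4\<close> is not isomorphic to \<open>M\<^sub>1\<close>, that the automorphisms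
  of \<open>M\<^sub>0\<close> are given by pairs \<open>(d, b)\<close> of units, and that those of \<open>M\<^sub>1\<close> are given by \<open>b\<close>, with
  \<open>d = b\<^sup>2\<close>.

  In \<open>M\<^sub>1\<close> the variable \<open>Y = x\<^sup>2\<close> is redundant, and a normal form argument shows that \<open>g\<close> and \<open>x\<close>
  with \<open>g\<^sup>2 = 1\<close> and \<open>xg = - gx\<close> present it (\<open>is_A_infinity_model_1\<close>). A Hopf algebra with this
  presentation and with the prescribed \<open>\<Delta>\<close> on the generators is unique up to isomorphism
  (\<open>is_A_infinity_unique\<close>), so \<open>A\<^sub>(\<^sub>\<infinity>\<^sub>)\<close> may be replaced by \<open>M\<^sub>1\<close>.

  Finally, the only unitary cocentral map \<open>H\<^sub>4 \<rightarrow> k[Y]\<close> is the trivial one, so no two different crossed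
  systems are equivalent and \<open>a\<close> parametrises the cohomology set (\<open>CS_rel_eq\<close>, \<open>H2_bij\<close>).
\<close>

section \<open>Linear extension\<close>

abbreviation coord :: "('b \<Rightarrow>\<^sub>0 'k::zero) \<Rightarrow> 'b \<Rightarrow> 'k" where
  "coord \<equiv> Poly_Mapping.lookup"

lemma klinear_iff:
  "klinear f \<longleftrightarrow> (\<forall>x y. f (x + y) = f x + f y) \<and> (\<forall>c x. f (smul c x) = smul c (f x))"
  by (simp add: Vector_Spaces.linear_iff fs.vector_space_axioms)

lemma lin_ext_superset:
  assumes "finite S" "Poly_Mapping.keys v \<subseteq> S"
  shows "lin_ext F v = (\<Sum>i\<in>S. smul (coord v i) (F i))"
  unfolding lin_ext_def using assms
  by (intro sum.mono_neutral_left) (auto simp: in_keys_iff)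

lemma lin_ext_add: "lin_ext F (v + w) = lin_ext F v + lin_ext F w"
proof -
  let ?S = "Poly_Mapping.keys v \<union> Poly_Mapping.keys w"
  have "lin_ext F u = (\<Sum>i\<in>?S. smul (coord u i) (F i))"
    if "Poly_Mapping.keys u \<subseteq> ?S" for u
    using that by (intro lin_ext_superset) auto
  from this[of v] this[of w] this[of "v + w"] show ?thesis
    using keys_add[of v w]
    by (simp add: lookup_add fs.scale_left_distrib sum.distrib)
qed

lemma lin_ext_smul: "lin_ext F (smul c v) = smul c (lin_ext F v)"
proof -
  have "lin_ext F (smul c v)
      = (\<Sum>i\<in>Poly_Mapping.keys v. smul (coord (smul c v) i) (F i))"
    by (intro lin_ext_superset) (auto simp: in_keys_iff)
  then show ?thesis
    by (simp add: lin_ext_def fs.scale_sum_right)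
qed

lemma klinear_lin_ext: "klinear (lin_ext F)"
  by (simp add: klinear_iff lin_ext_add lin_ext_smul)

lemma lin_ext_bvec [simp]: "lin_ext F (bvec i) = F i"
  by (simp add: lin_ext_def)

lemma klinearD:
  assumes "klinear f"
  shows "f (x + y) = f x + f y" "f (smul c x) = smul c (f x)" "f 0 = 0" "f (- x) = - f x"
    "f (x - y) = f x - f y"
proof -
  interpret Vector_Spaces.linear smul smul f by fact
  show "f (x + y) = f x + f y" "f (smul c x) = smul c (f x)" "f 0 = 0" "f (- x) = - f x"
    "f (x - y) = f x - f y"
    by (simp_all add: add scale neg diff)
qed

lemma klinear_sum: "klinear f \<Longrightarrow> f (\<Sum>i\<in>S. g i) = (\<Sum>i\<in>S. f (g i))"
  by (induction S rule: infinite_finite_induct) (simp_all add: klinearD)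

lemmas lin_ext_linear [simp] = klinearD[OF klinear_lin_ext]

lemma single_eq_smul: "Poly_Mapping.single i c = smul c (bvec i)"
  by (rule poly_mapping_eqI) (simp add: lookup_single when_def)

lemma vec_induct [case_names zero add smul basis]:
  assumes "P 0" "\<And>v w. P v \<Longrightarrow> P w \<Longrightarrow> P (v + w)" "\<And>c v. P v \<Longrightarrow> P (smul c v)" "\<And>i. P (bvec i)"
  shows "P (v :: 'b \<Rightarrow>\<^sub>0 'k::field)"
proof -
  have "v = (\<Sum>i\<in>Poly_Mapping.keys v. smul (coord v i) (bvec i))"
    by (rule poly_mapping_eqI)
      (simp add: lookup_sum lookup_single when_def if_distrib sum.delta' in_keys_iff cong: if_cong)
  moreover have "P (\<Sum>i\<in>S. smul (coord v i) (bvec i))" if "finite S" for S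
    using that by (induction S) (auto intro: assms)
  ultimately show ?thesis by (metis finite_keys)
qed

lemma klinear_eqI:
  assumes "klinear f" "klinear g" "\<And>i. f (bvec i) = g (bvec i)"
  shows "f v = g v"
  by (induction v rule: vec_induct) (simp_all add: klinearD[OF assms(1)] klinearD[OF assms(2)]
      assms(3))

named_theorems klinear_intros

lemma klinear_id [klinear_intros]: "klinear (\<lambda>x. x)"
  and klinear_zero [klinear_intros]: "klinear (\<lambda>x. 0)"
  by (simp_all add: klinear_iff)

lemma klinear_comp: "klinear g \<Longrightarrow> klinear f \<Longrightarrow> klinear (\<lambda>x. g (f x))"
  by (simp add: klinear_iff)

lemma klinear_lin_ext_arg [klinear_intros]: "klinear f \<Longrightarrow> klinear (\<lambda>x. lin_ext F (f x))"
  by (rule klinear_comp[OF klinear_lin_ext])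

lemma klinear_lin_ext_fun [klinear_intros]:
  assumes "\<And>i. klinear (\<lambda>x. F x i)"
  shows "klinear (\<lambda>x. lin_ext (F x) v)"
proof -
  have "F (x + y) i = F x i + F y i" "F (smul c x) i = smul c (F x i)" for x y c i
    using assms[of i] by (simp_all add: klinear_iff)
  then show ?thesis
    by (simp add: klinear_iff lin_ext_def fs.scale_right_distrib sum.distrib fs.scale_sum_right
        mult.commute)
qed

section \<open>Tensor products\<close>

lemma tens_bvec [simp]: "bvec i \<otimes>\<^sub>k bvec j = bvec (i, j)"
  by (simp add: tens_def)

lemma klinear_tens_left [klinear_intros]: "klinear f \<Longrightarrow> klinear (\<lambda>x. f x \<otimes>\<^sub>k w)"
  and klinear_tens_right [klinear_intros]: "klinear f \<Longrightarrow> klinear (\<lambda>x. w \<otimes>\<^sub>k f x)"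
  unfolding tens_def by (intro klinear_intros; assumption)+

lemmas tens_linear [simp] = klinearD[OF klinear_tens_left[OF klinear_id]]
  klinearD[OF klinear_tens_right[OF klinear_id]]

lemma lookup_tens [simp]:
  "coord (v \<otimes>\<^sub>k w) (i, j) = coord v i * coord w j"
proof (induction v rule: vec_induct)
  case (basis i')
  show ?case
    by (induction w rule: vec_induct)
      (auto simp: lookup_add lookup_single when_def algebra_simps)
qed (auto simp: lookup_add algebra_simps)

lemma klinear_tlift: "klinear (tlift F)"
  by (simp add: tlift_def klinear_lin_ext)

lemmas tlift_linear [simp] = klinearD[OF klinear_tlift]

lemma tlift_bvec [simp]: "tlift F (bvec (i, j)) = F (bvec i) (bvec j)"
  by (simp add: tlift_def)

lemma klinear_tlift_arg [klinear_intros]: "klinear f \<Longrightarrow> klinear (\<lambda>x. tlift F (f x))"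
  by (rule klinear_comp[OF klinear_tlift])

lemma klinear_tlift_fun [klinear_intros]:
  assumes "\<And>i j. klinear (\<lambda>x. F x (bvec i) (bvec j))"
  shows "klinear (\<lambda>x. tlift (F x) v)"
  unfolding tlift_def by (rule klinear_lin_ext_fun) (use assms in auto)

lemma bilinear_eqI:
  assumes "\<And>x. klinear (\<lambda>y. F x y)" "\<And>y. klinear (\<lambda>x. F x y)"
    "\<And>x. klinear (\<lambda>y. G x y)" "\<And>y. klinear (\<lambda>x. G x y)"
    "\<And>i j. F (bvec i) (bvec j) = G (bvec i) (bvec j)"
  shows "F v w = G v w"
proof (rule klinear_eqI[where f = "\<lambda>v. F v w"])
  show "F (bvec i) w = G (bvec i) w" for i
    by (rule klinear_eqI[where f = "F (bvec i)"]) (use assms in auto)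
qed (use assms in auto)

text \<open>
  \<open>tlift F\<close> only evaluates \<open>F\<close> at basis vectors, so it is linear for every \<open>F\<close>. Bilinearity of
  \<open>F\<close> enters here: it makes the value on a pure tensor independent of the basis.
\<close>

lemma tlift_tens:
  assumes "\<And>x. klinear (\<lambda>y. F x y)" "\<And>y. klinear (\<lambda>x. F x y)"
  shows "tlift F (v \<otimes>\<^sub>k w) = F v w"
  by (rule bilinear_eqI[where G = F]) (auto intro!: klinear_intros assms)

lemma tensor_eqI:
  assumes "klinear f" "klinear g" "\<And>i j. f (bvec (i, j)) = g (bvec (i, j))"
  shows "f v = g v"
  by (rule klinear_eqI[where f = f]) (use assms in auto)

lemma klinear_sw2_arg [klinear_intros]:
  "klinear (comult L) \<Longrightarrow> klinear f \<Longrightarrow> klinear (\<lambda>x. sw2 L (f x) F)"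
  unfolding sw2_def by (rule klinear_tlift_arg) (rule klinear_comp)

lemma klinear_sw2_fun [klinear_intros]:
  "(\<And>i j. klinear (\<lambda>x. F x (bvec i) (bvec j))) \<Longrightarrow> klinear (\<lambda>x. sw2 L v (F x))"
  unfolding sw2_def by (intro klinear_intros)

section \<open>Tensor products of algebras\<close>

lemma is_algebraD:
  assumes "is_algebra L"
  shows "klinear f \<Longrightarrow> klinear (\<lambda>y. amult L x (f y))" "klinear f \<Longrightarrow> klinear (\<lambda>x. amult L (f x) y)"
    "amult L (amult L x y) z = amult L x (amult L y z)"
    "amult L (aone L) x = x" "amult L x (aone L) = x"
proof -
  have *: "klinear (amult L x)" "klinear (\<lambda>x. amult L x y)"
    using assms by (auto simp: is_algebra_def)
  show "klinear (\<lambda>y. amult L x (f y))" if "klinear f"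
    using klinear_comp[OF *(1) that] .
  show "klinear (\<lambda>x. amult L (f x) y)" if "klinear f"
    using klinear_comp[OF *(2) that] .
  show "amult L (amult L x y) z = amult L x (amult L y z)" "amult L (aone L) x = x"
      "amult L x (aone L) = x"
    using assms unfolding is_algebra_def by blast+
qed

lemma klinear_amult_tensor [klinear_intros]:
  "klinear f \<Longrightarrow> klinear (\<lambda>y. amult (tensor_hopf A B) x (f y))"
  "klinear f \<Longrightarrow> klinear (\<lambda>x. amult (tensor_hopf A B) (f x) y)"
  unfolding tensor_hopf_def by (auto intro!: klinear_intros simp del: split_paired_All)

lemmas amult_tensor_linear [simp] = klinearD[OF klinear_amult_tensor(1)[OF klinear_id]]
  klinearD[OF klinear_amult_tensor(2)[OF klinear_id]]

lemma amult_tensor_bvec [simp]: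
  "amult (tensor_hopf A B) (bvec (i, j)) (bvec (i', j')) =
     amult A (bvec i) (bvec i') \<otimes>\<^sub>k amult B (bvec j) (bvec j')"
  by (simp add: tensor_hopf_def)

lemma amult_tensor_tens:
  assumes "is_algebra A" "is_algebra B"
  shows "amult (tensor_hopf A B) (a \<otimes>\<^sub>k b) (c \<otimes>\<^sub>k d) = amult A a c \<otimes>\<^sub>k amult B b d"
proof -
  note A = is_algebraD(1,2)[OF assms(1)] and B = is_algebraD(1,2)[OF assms(2)]
  have *: "amult (tensor_hopf A B) (bvec i \<otimes>\<^sub>k bvec j) (c \<otimes>\<^sub>k d) =
      amult A (bvec i) c \<otimes>\<^sub>k amult B (bvec j) d" for i j
    by (rule bilinear_eqI[where F = "\<lambda>c d. amult (tensor_hopf A B) (bvec i \<otimes>\<^sub>k bvec j) (c \<otimes>\<^sub>k d)"])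
      (auto intro!: klinear_intros A B)
  show ?thesis
    by (rule bilinear_eqI[where F = "\<lambda>a b. amult (tensor_hopf A B) (a \<otimes>\<^sub>k b) (c \<otimes>\<^sub>k d)"])
      (simp_all only: *, auto intro!: klinear_intros A B)
qed

lemma is_algebraI:
  assumes "\<And>x. klinear (\<lambda>y. amult L x y)" "\<And>y. klinear (\<lambda>x. amult L x y)"
    "\<And>i j l. amult L (amult L (bvec i) (bvec j)) (bvec l) =
        amult L (bvec i) (amult L (bvec j) (bvec l))"
    "\<And>i. amult L (aone L) (bvec i) = bvec i" "\<And>i. amult L (bvec i) (aone L) = bvec i"
  shows "is_algebra L"
proof -
  have lin: "klinear f \<Longrightarrow> klinear (\<lambda>y. amult L x (f y))" "klinear f \<Longrightarrow> klinear (\<lambda>x. amult L (f x) y)"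
      for x y f
    by (rule klinear_comp[OF assms(1)] klinear_comp[OF assms(2)], assumption)+
  have 1: "amult L (amult L (bvec i) (bvec j)) z = amult L (bvec i) (amult L (bvec j) z)" for i j z
    by (rule klinear_eqI[where f = "\<lambda>z. amult L (amult L (bvec i) (bvec j)) z"])
      (intro lin klinear_intros assms(3))+
  have 2: "amult L (amult L (bvec i) y) z = amult L (bvec i) (amult L y z)" for i y z
    by (rule klinear_eqI[where f = "\<lambda>y. amult L (amult L (bvec i) y) z"])
      (intro lin klinear_intros 1)+
  have 3: "amult L (amult L x y) z = amult L x (amult L y z)" for x y z
    by (rule klinear_eqI[where f = "\<lambda>x. amult L (amult L x y) z"])
      (intro lin klinear_intros 2)+
  have 4: "amult L (aone L) x = x" "amult L x (aone L) = x" for x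
    by (rule klinear_eqI[where f = "\<lambda>x. amult L (aone L) x"]
        klinear_eqI[where f = "\<lambda>x. amult L x (aone L)"];
        intro lin klinear_intros assms)+
  show ?thesis unfolding is_algebra_def using assms(1,2) 3 4 by auto
qed

lemma is_algebra_tensor:
  assumes "is_algebra A" "is_algebra B"
  shows "is_algebra (tensor_hopf A B)"
proof (rule is_algebraI)
  note A = is_algebraD[OF assms(1)] and B = is_algebraD[OF assms(2)]
  note T = amult_tensor_tens[OF assms]
  have one: "aone (tensor_hopf A B) = aone A \<otimes>\<^sub>k aone B" by (simp add: tensor_hopf_def)
  fix p q r :: "'a \<times> 'c"
  obtain i j where p: "p = (i, j)" by force
  obtain i' j' where q: "q = (i', j')" by force
  obtain i'' j'' where r: "r = (i'', j'')" by force
  show "amult (tensor_hopf A B) (amult (tensor_hopf A B) (bvec p) (bvec q)) (bvec r) =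
    amult (tensor_hopf A B) (bvec p) (amult (tensor_hopf A B) (bvec q) (bvec r))"
    unfolding p q r tens_bvec[symmetric] T A(3) B(3) ..
  show "amult (tensor_hopf A B) (aone (tensor_hopf A B)) (bvec p) = bvec p"
    "amult (tensor_hopf A B) (bvec p) (aone (tensor_hopf A B)) = bvec p"
    unfolding p tens_bvec[symmetric] T one A(4,5) B(4,5) by (rule refl)+
qed (intro klinear_intros)+

section \<open>Coordinates in \<open>k[Y]\<close> and \<open>H\<^sub>4\<close>\<close>

lemma lin_ext_one [simp]: "lin_ext F (1 :: nat \<Rightarrow>\<^sub>0 'k::field) = F 0"
  by (simp flip: single_one)

lemma tens_one_left [simp]: "(1 :: nat \<Rightarrow>\<^sub>0 'k::field) \<otimes>\<^sub>k bvec j = bvec (0, j)"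
  and tens_one_right [simp]: "bvec i \<otimes>\<^sub>k (1 :: nat \<Rightarrow>\<^sub>0 'k::field) = bvec (i, 0)"
  and tens_one_one [simp]: "(1 :: nat \<Rightarrow>\<^sub>0 'k::field) \<otimes>\<^sub>k (1 :: nat \<Rightarrow>\<^sub>0 'k) = bvec (0, 0)"
  by (simp_all flip: single_one)

lemma polyY_simps [simp]:
  "amult polyY = (*)" "aone polyY = 1" "counit polyY p = coord p 0"
  by (simp_all add: polyY_def)

lemma klinear_comult_polyY [klinear_intros]: "klinear (comult polyY)"
  by (simp add: polyY_def klinear_lin_ext)

lemma bvec_power: "(bvec (i, j) :: nat \<times> nat \<Rightarrow>\<^sub>0 'k::field) ^ n = bvec (n * i, n * j)"
  by (induction n) (simp_all add: mult_single flip: zero_prod_def)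

lemma comult_polyY_bvec:
  "comult polyY (bvec n :: nat \<Rightarrow>\<^sub>0 'k::field) =
      (\<Sum>k\<le>n. smul (of_nat (n choose k)) (bvec (k, n - k)))"
proof -
  have "of_nat m * v * w = smul (of_nat m) (v * w)" for m and v w :: "nat \<times> nat \<Rightarrow>\<^sub>0 'k"
    by (induction m) (simp_all add: algebra_simps)
  then show ?thesis
    by (simp add: polyY_def binomial_ring bvec_power mult_single)
qed

lemma sw2_polyY_bvec:
  "sw2 polyY (bvec n :: nat \<Rightarrow>\<^sub>0 'k::field) F =
     (\<Sum>k\<le>n. smul (of_nat (n choose k)) (F (bvec k) (bvec (n - k))))"
  by (simp add: sw2_def comult_polyY_bvec klinear_sum[OF klinear_tlift])

lemma h4_simps [simp]:
  "amult sweedlerH4 (bvec a) (bvec b) = h4_mult a b" "aone sweedlerH4 = bvec H4_1"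
  "counit sweedlerH4 p = coord p H4_1 + coord p H4_g"
  "comult sweedlerH4 (bvec a) = h4_comult a"
  by (simp_all add: sweedlerH4_def)

lemma klinear_sweedler [klinear_intros]:
  "klinear (comult sweedlerH4)" "klinear f \<Longrightarrow> klinear (\<lambda>x. amult sweedlerH4 (f x) y)"
  "klinear f \<Longrightarrow> klinear (\<lambda>y. amult sweedlerH4 x (f y))"
  by (auto simp: sweedlerH4_def intro!: klinear_intros klinear_lin_ext)

lemmas sweedler_linear [simp] = klinearD[OF klinear_sweedler(1)]
  klinearD[OF klinear_sweedler(2)[OF klinear_id]] klinearD[OF klinear_sweedler(3)[OF klinear_id]]

lemma sw2_H4 [simp]:
  "sw2 sweedlerH4 (bvec H4_1) F = F (bvec H4_1) (bvec H4_1)"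
  "sw2 sweedlerH4 (bvec H4_g) F = F (bvec H4_g) (bvec H4_g)"
  "sw2 sweedlerH4 (bvec H4_x) F = F (bvec H4_x) (bvec H4_1) + F (bvec H4_g) (bvec H4_x)"
  "sw2 sweedlerH4 (bvec H4_gx) F = F (bvec H4_gx) (bvec H4_g) + F (bvec H4_1) (bvec H4_gx)"
  by (simp_all add: sw2_def)

section \<open>The coalgebra \<open>k[Y] \<otimes> H\<^sub>4\<close>\<close>

text \<open>
  The comultiplication of \<open>H\<^sub>4\<close> has structure constants \<open>0\<close> and \<open>1\<close>, and \<open>u \<otimes> v\<close> occurs in
  \<open>\<Delta>(w)\<close> for at most one basis element \<open>w\<close>. Thus \<open>\<Delta>\<close> is dual to a partial multiplication
  \<open>h4_join\<close> of the basis, with \<open>None\<close> for the product \<open>0\<close> of two dual basis elements.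
\<close>

fun h4_join :: "h4 \<Rightarrow> h4 \<Rightarrow> h4 option" where
  "h4_join H4_1 H4_1 = Some H4_1"
| "h4_join H4_g H4_g = Some H4_g"
| "h4_join H4_x H4_1 = Some H4_x"
| "h4_join H4_g H4_x = Some H4_x"
| "h4_join H4_gx H4_g = Some H4_gx"
| "h4_join H4_1 H4_gx = Some H4_gx"
| "h4_join _ _ = None"

abbreviation dlt :: "(nat \<times> h4 \<Rightarrow>\<^sub>0 'k::field) \<Rightarrow> ((nat \<times> h4) \<times> (nat \<times> h4) \<Rightarrow>\<^sub>0 'k)" where
  "dlt \<equiv> tensor_comult polyY sweedlerH4"

lemma klinear_tensor_comult: "klinear (tensor_comult A H)"
  by (simp add: tensor_comult_def klinear_tlift)

lemmas tensor_comult_linear [simp] = klinearD[OF klinear_tensor_comult]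

lemma lookup_binomial_sum:
  "coord (\<Sum>k\<le>n. smul (of_nat (n choose k)) (bvec ((k, p), (n - k, q)) :: _ \<Rightarrow>\<^sub>0 'k::field))
      ((i, u), (j, v)) =
    (if p = u \<and> q = v \<and> n = i + j then of_nat (n choose i) else 0)"
proof -
  have "(\<Sum>k\<le>n. of_nat (n choose k) * (1 when ((k, p), (n - k, q)) = ((i, u), (j, v)))) =
      (\<Sum>k\<le>n. (if k = i then (if p = u \<and> q = v \<and> n = i + j then of_nat (n choose i) else 0) else
          (0::'k)))"
    by (intro sum.cong) (auto simp: when_def)
  also have "\<dots> = (if p = u \<and> q = v \<and> n = i + j then of_nat (n choose i) else 0)"
    by auto
  finally show ?thesis
    by (simp add: lookup_sum lookup_single)
qed

text \<open>
  The comultiplication of \<open>k[Y] \<otimes> H\<^sub>4\<close> in coordinates. All later arguments about group-like and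
  primitive elements, and about the values of a crossed system, compare single coordinates by
  means of this formula.
\<close>

lemma lookup_dlt:
  "coord (dlt t) ((i, u), (j, v)) =
     of_nat ((i + j) choose i) * (case h4_join u v of None \<Rightarrow> 0 | Some w \<Rightarrow> coord t (i + j, w))"
proof (induction t rule: vec_induct)
  case (basis s)
  obtain n h where s: "s = (n, h)" by force
  have *: "dlt (bvec (n, h)) = (\<Sum>k\<le>n. smul (of_nat (n choose k))
      (sw2 sweedlerH4 (bvec h) (\<lambda>h1 h2. (bvec k \<otimes>\<^sub>k h1) \<otimes>\<^sub>k (bvec (n - k) \<otimes>\<^sub>k h2))))"
    by (simp add: tensor_comult_def sw2_polyY_bvec)
  show ?case unfolding s *
    by (cases h; cases u; cases v)
      (auto simp: fs.scale_right_distrib sum.distrib lookup_add lookup_binomial_sum lookup_single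
          when_def)
qed (auto simp: lookup_add algebra_simps split: option.split)

lemma tensor_counit_polyY_H4 [simp]:
  "tensor_counit polyY sweedlerH4 t = coord t (0, H4_1) + coord t (0, H4_g)"
proof -
  have "tensor_counit polyY sweedlerH4 t = (\<Sum>s\<in>Poly_Mapping.keys t.
      (if s = (0, H4_1) then coord t s else 0) +
      (if s = (0, H4_g) then coord t s else 0))"
    unfolding tensor_counit_def
    by (intro sum.cong refl) (auto simp: lookup_single when_def split: prod.splits)
  then show ?thesis
    by (simp add: sum.distrib in_keys_iff)
qed

lemma dlt_bvec_sum:
  "dlt (bvec (n, h) :: _ \<Rightarrow>\<^sub>0 'k::field) = (\<Sum>k\<le>n. smul (of_nat (n choose k))
      (sw2 sweedlerH4 (bvec h) (\<lambda>h1 h2. (bvec k \<otimes>\<^sub>k h1) \<otimes>\<^sub>k (bvec (n - k) \<otimes>\<^sub>k h2))))"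
  by (simp add: tensor_comult_def sw2_polyY_bvec)

lemma dlt_bvec [simp]:
  "dlt (bvec (0, H4_1)) = bvec ((0, H4_1), (0, H4_1))"
  "dlt (bvec (0, H4_g)) = bvec ((0, H4_g), (0, H4_g))"
  "dlt (bvec (0, H4_x)) = bvec ((0, H4_x), (0, H4_1)) + bvec ((0, H4_g), (0, H4_x))"
  "dlt (bvec (0, H4_gx)) = bvec ((0, H4_gx), (0, H4_g)) + bvec ((0, H4_1), (0, H4_gx))"
  by (simp_all add: dlt_bvec_sum)

lemma dlt_bvec_Suc0 [simp]:
  "dlt (bvec (Suc 0, H4_1)) = bvec ((Suc 0, H4_1), (0, H4_1)) + bvec ((0, H4_1), (Suc 0, H4_1))"
  "dlt (bvec (Suc 0, H4_g)) = bvec ((Suc 0, H4_g), (0, H4_g)) + bvec ((0, H4_g), (Suc 0, H4_g))"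
  by (simp_all add: dlt_bvec_sum add_ac)

lemma lookup_tlift_tens_left:
  "coord (tlift (\<lambda>a b. a \<otimes>\<^sub>k b \<otimes>\<^sub>k w) S) (p, q, r) =
     coord S (p, q) * coord w r"
proof (induction S rule: vec_induct)
  case (basis s)
  then show ?case by (cases s) (auto simp: lookup_single when_def)
qed (auto simp: lookup_add algebra_simps)

lemma lookup_tlift_tens_right:
  "coord (tlift (\<lambda>a b. v \<otimes>\<^sub>k a \<otimes>\<^sub>k b) S) (p, q, r) =
     coord v p * coord S (q, r)"
proof (induction S rule: vec_induct)
  case (basis s)
  then show ?case by (cases s) (auto simp: lookup_single when_def)
qed (auto simp: lookup_add algebra_simps)

lemma dlt_coassoc_left:
  "coord (tlift (\<lambda>h' h3. tlift (\<lambda>h1 h2. h1 \<otimes>\<^sub>k h2 \<otimes>\<^sub>k h3) (dlt h')) T) ((i, u), (j, v), r) =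
    of_nat ((i + j) choose i) * (case h4_join u v of None \<Rightarrow> 0 | Some w \<Rightarrow> coord T ((i + j, w), r))"
proof (induction T rule: vec_induct)
  case (basis s)
  then show ?case
    by (cases s) (auto simp: lookup_tlift_tens_left lookup_dlt lookup_single when_def
        split: option.split)
qed (auto simp: lookup_add algebra_simps split: option.split)

lemma dlt_coassoc_right:
  "coord (tlift (\<lambda>h1 h'. tlift (\<lambda>h2 h3. h1 \<otimes>\<^sub>k h2 \<otimes>\<^sub>k h3) (dlt h')) T) (r, (i, u), (j, v)) =
    of_nat ((i + j) choose i) * (case h4_join u v of None \<Rightarrow> 0 | Some w \<Rightarrow> coord T (r, (i + j, w)))"
proof (induction T rule: vec_induct)
  case (basis s)
  then show ?case
    by (cases s) (auto simp: lookup_tlift_tens_right lookup_dlt lookup_single when_def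
        split: option.split)
qed (auto simp: lookup_add algebra_simps split: option.split)

text \<open>
  The binomial coefficients form a 2-cocycle on the additive monoid of natural numbers (both sides
  are the trinomial coefficient); this is coassociativity of \<open>k[Y]\<close>.
\<close>

lemma choose_cocycle:
  "((i + j) choose i) * ((i + j + l) choose (i + j)) =
      ((j + l) choose j) * ((i + (j + l)) choose i)"
proof -
  have "((i + j + l) choose (i + j)) * ((i + j) choose i) =
      ((i + j + l) choose i) * ((i + j + l - i) choose (i + j - i))"
    by (rule choose_mult) auto
  then show ?thesis by (simp add: algebra_simps)
qed

text \<open>
  In coordinates, both sides reduce to a product in the dual algebra, so that the claim is the
  cocycle identity together with associativity of \<^const>\<open>h4_join\<close>.
\<close>

lemma dlt_coassoc:
  "tlift (\<lambda>h' h3. tlift (\<lambda>h1 h2. h1 \<otimes>\<^sub>k h2 \<otimes>\<^sub>k h3) (dlt h')) (dlt t) =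
   tlift (\<lambda>h1 h'. tlift (\<lambda>h2 h3. h1 \<otimes>\<^sub>k h2 \<otimes>\<^sub>k h3) (dlt h')) (dlt (t :: nat \<times> h4 \<Rightarrow>\<^sub>0 'k::field))"
proof (rule poly_mapping_eqI)
  fix s :: "(nat \<times> h4) \<times> (nat \<times> h4) \<times> (nat \<times> h4)"
  obtain i u j v l w where s: "s = ((i, u), (j, v), (l, w))" by (metis surj_pair)
  have c: "of_nat ((i + j) choose i) * (of_nat ((i + j + l) choose (i + j)) * z) =
      (of_nat ((j + l) choose j) * (of_nat ((i + (j + l)) choose i) * z) :: 'k)" for z
    unfolding mult.assoc[symmetric] of_nat_mult[symmetric] choose_cocycle ..
  show "coord (tlift (\<lambda>h' h3. tlift (\<lambda>h1 h2. h1 \<otimes>\<^sub>k h2 \<otimes>\<^sub>k h3) (dlt h')) (dlt t)) s =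
     coord (tlift (\<lambda>h1 h'. tlift (\<lambda>h2 h3. h1 \<otimes>\<^sub>k h2 \<otimes>\<^sub>k h3) (dlt h')) (dlt t)) s"
    unfolding s dlt_coassoc_left dlt_coassoc_right lookup_dlt
    using c by (cases u; cases v; cases w) (simp_all add: lookup_dlt add.assoc)
qed

lemma dlt_counit_left:
  "tlift (\<lambda>h1 h2. smul (tensor_counit polyY sweedlerH4 h1) h2) (dlt t) = t"
proof -
  have "coord (tlift (\<lambda>h1 h2. smul (tensor_counit polyY sweedlerH4 h1) h2) T) q =
      coord T ((0, H4_1), q) + coord T ((0, H4_g), q)" for T q
  proof (induction T rule: vec_induct)
    case (basis s)
    then show ?case by (cases s) (auto simp: lookup_single when_def)
  qed (simp_all add: lookup_add algebra_simps)
  note * = this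
  show ?thesis
  proof (rule poly_mapping_eqI)
    fix q :: "nat \<times> h4"
    obtain j v where "q = (j, v)" by force
    then show "coord (tlift (\<lambda>h1 h2. smul (tensor_counit polyY sweedlerH4 h1) h2) (dlt t)) q =
        coord t q"
      unfolding * by (cases v) (simp_all add: lookup_dlt)
  qed
qed

lemma dlt_counit_right:
  "tlift (\<lambda>h1 h2. smul (tensor_counit polyY sweedlerH4 h2) h1) (dlt t) = t"
proof -
  have "coord (tlift (\<lambda>h1 h2. smul (tensor_counit polyY sweedlerH4 h2) h1) T) q =
      coord T (q, (0, H4_1)) + coord T (q, (0, H4_g))" for T q
  proof (induction T rule: vec_induct)
    case (basis s)
    then show ?case by (cases s) (auto simp: lookup_single when_def)
  qed (simp_all add: lookup_add algebra_simps)
  note * = this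
  show ?thesis
  proof (rule poly_mapping_eqI)
    fix q :: "nat \<times> h4"
    obtain j v where "q = (j, v)" by force
    then show "coord (tlift (\<lambda>h1 h2. smul (tensor_counit polyY sweedlerH4 h2) h1) (dlt t)) q =
        coord t q"
      unfolding * by (cases v) (simp_all add: lookup_dlt)
  qed
qed

section \<open>The Hopf algebras with \<open>x\<^sup>2 = aY\<close>\<close>

text \<open>
  The algebra with \<open>k[Y]\<close>-basis \<open>1, g, x, gx\<close> and \<open>g\<^sup>2 = 1\<close>, \<open>xg = - gx\<close>, \<open>x\<^sup>2 = aY\<close>. A product of two
  basis elements \<open>Y\<^sup>nh\<close> and \<open>Y\<^sup>mh'\<close> is a scalar multiple of a basis element; \<open>h4_prod\<close> is its
  \<open>H\<^sub>4\<close>-component (multiplication in the Klein four-group), \<open>h4_deg\<close> the additional power of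
  \<open>Y\<close> and \<open>h4_scal\<close> the scalar, where the sign comes from moving an \<open>x\<close> past a \<open>g\<close>.
\<close>

fun h4_odd :: "h4 \<Rightarrow> bool" where
  "h4_odd H4_1 = False" | "h4_odd H4_g = False" | "h4_odd H4_x = True" | "h4_odd H4_gx = True"

fun h4_prod :: "h4 \<Rightarrow> h4 \<Rightarrow> h4" where
  "h4_prod H4_1 b = b"
| "h4_prod a H4_1 = a"
| "h4_prod H4_g H4_g = H4_1"
| "h4_prod H4_g H4_x = H4_gx"
| "h4_prod H4_g H4_gx = H4_x"
| "h4_prod H4_x H4_g = H4_gx"
| "h4_prod H4_x H4_x = H4_1"
| "h4_prod H4_x H4_gx = H4_g"
| "h4_prod H4_gx H4_g = H4_x"
| "h4_prod H4_gx H4_x = H4_g"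
| "h4_prod H4_gx H4_gx = H4_1"

definition h4_scal :: "'k::field \<Rightarrow> h4 \<Rightarrow> h4 \<Rightarrow> 'k" where
  "h4_scal a h h' = (if h4_odd h \<and> h4_odd h' then a else 1) *
      (if h4_odd h \<and> h' \<in> {H4_g, H4_gx} then -1 else 1)"

definition h4_deg :: "h4 \<Rightarrow> h4 \<Rightarrow> nat" where
  "h4_deg h h' = (if h4_odd h \<and> h4_odd h' then 1 else 0)"

definition model_tab :: "'k::field \<Rightarrow> nat \<times> h4 \<Rightarrow> nat \<times> h4 \<Rightarrow> (nat \<times> h4 \<Rightarrow>\<^sub>0 'k)" where
  "model_tab a s t = smul (h4_scal a (snd s) (snd t))
     (bvec (fst s + fst t + h4_deg (snd s) (snd t), h4_prod (snd s) (snd t)))"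

definition model :: "'k::field \<Rightarrow> (nat \<times> h4, 'k) hopf_str" where
  "model a = \<lparr>amult = \<lambda>s t. lin_ext (\<lambda>i. lin_ext (\<lambda>j. model_tab a i j) t) s,
     aone = bvec (0, H4_1),
     comult = tensor_comult polyY sweedlerH4,
     counit = tensor_counit polyY sweedlerH4\<rparr>"

lemma model_simps [simp]:
  "amult (model a) (bvec (n, h)) (bvec (m, h')) =
     smul (h4_scal a h h') (bvec (n + m + h4_deg h h', h4_prod h h'))"
  "aone (model a) = bvec (0, H4_1)" "comult (model a) = dlt"
  "counit (model a) = tensor_counit polyY sweedlerH4"
  by (simp_all add: model_def model_tab_def)

lemma klinear_amult_model [klinear_intros]:
  "klinear f \<Longrightarrow> klinear (\<lambda>y. amult (model a) x (f y))"
  "klinear f \<Longrightarrow> klinear (\<lambda>x. amult (model a) (f x) y)"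
  by (auto simp: model_def intro!: klinear_intros)

lemmas amult_model_linear [simp] = klinearD[OF klinear_amult_model(1)[OF klinear_id]]
  klinearD[OF klinear_amult_model(2)[OF klinear_id]]

lemma is_algebra_model: "is_algebra (model a)"
proof (rule is_algebraI)
  fix p q r :: "nat \<times> h4"
  obtain i u j v l w where s: "p = (i, u)" "q = (j, v)" "r = (l, w)" by (metis surj_pair)
  show "amult (model a) (amult (model a) (bvec p) (bvec q)) (bvec r) =
      amult (model a) (bvec p) (amult (model a) (bvec q) (bvec r))"
    unfolding s by (cases u; cases v; cases w) (simp_all add: h4_scal_def h4_deg_def add.assoc)
  show "amult (model a) (aone (model a)) (bvec p) = bvec p"
      "amult (model a) (bvec p) (aone (model a)) = bvec p"
    unfolding s by (cases u; simp add: h4_scal_def h4_deg_def)+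
qed (intro klinear_intros)+

lemma is_coalgebra_model: "is_coalgebra (model a)"
  unfolding is_coalgebra_def sw2_def model_simps
proof (intro conjI allI)
  show "klinear dlt" by (rule klinear_tensor_comult)
  show "Vector_Spaces.linear smul (*) (tensor_counit polyY sweedlerH4)"
    unfolding Vector_Spaces.linear_iff
    by (intro conjI fs.vector_space_axioms, unfold_locales) (simp_all add: lookup_add algebra_simps)
qed (rule dlt_coassoc dlt_counit_left dlt_counit_right)+

lemma lookup_Y_mult:
  "coord (amult (model a) (bvec (Suc 0, H4_1)) t) (i, u) =
     (case i of 0 \<Rightarrow> 0 | Suc i' \<Rightarrow> coord t (i', u))"
proof (induction t rule: vec_induct)
  case (basis s)
  then show ?case
    by (cases s; cases "snd s") (auto simp: h4_scal_def h4_deg_def lookup_single when_def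
        split: nat.split)
qed (auto simp: lookup_add split: nat.split)

lemma Y_mult_bvec: "amult (model a) (bvec (Suc 0, H4_1)) (bvec (n, h)) = bvec (Suc n, h)"
  by (simp add: h4_scal_def h4_deg_def)

abbreviation "mtens a \<equiv> tensor_hopf (model a) (model a)"

text \<open>
  Multiplication by \<open>\<Delta>(Y) = Y \<otimes> 1 + 1 \<otimes> Y\<close> shifts the degree in one of the two factors;
  compatibility with \<open>\<Delta>\<close> is then Pascal's rule.
\<close>

lemma lookup_Y_mult_tensor:
  "coord (amult (mtens a) (dlt (bvec (Suc 0, H4_1))) T) ((i, u), (j, v)) =
     (case i of 0 \<Rightarrow> 0 | Suc i' \<Rightarrow> coord T ((i', u), (j, v))) +
     (case j of 0 \<Rightarrow> 0 | Suc j' \<Rightarrow> coord T ((i, u), (j', v)))"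
proof (induction T rule: vec_induct)
  case (basis s)
  obtain n h m h' where s: "s = ((n, h), (m, h'))" by (metis surj_pair)
  show ?case unfolding s
    by (auto simp: h4_scal_def h4_deg_def lookup_single lookup_add when_def split: nat.split)
qed (auto simp: lookup_add algebra_simps simp del: dlt_bvec_Suc0 split: nat.split)

lemma dlt_Y_mult:
  fixes a :: "'k::field"
  shows "dlt (amult (model a) (bvec (Suc 0, H4_1)) t) =
      amult (mtens a) (dlt (bvec (Suc 0, H4_1))) (dlt t)"
proof (rule poly_mapping_eqI)
  fix s :: "(nat \<times> h4) \<times> (nat \<times> h4)"
  obtain i u j v where s: "s = ((i, u), (j, v))" by (metis surj_pair)
  show "coord (dlt (amult (model a) (bvec (Suc 0, H4_1)) t)) s =
      coord (amult (mtens a) (dlt (bvec (Suc 0, H4_1))) (dlt t)) s"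
    unfolding s lookup_Y_mult_tensor lookup_dlt
    by (cases i; cases j) (simp_all add: lookup_Y_mult algebra_simps split: option.split)
qed

text \<open>
  The elements \<open>s\<close> that satisfy the equation for all \<open>t\<close> are closed under products, because
  \<open>M \<otimes> M\<close> is associative. Hence it suffices to treat the generators \<open>Y, g, x\<close>. For \<open>g\<close> and \<open>x\<close>,
  centrality of \<open>Y\<close> and of \<open>\<Delta>(Y)\<close> relative to \<open>\<Delta>(g)\<close>, \<open>\<Delta>(x)\<close> reduces to \<open>t\<close> of degree \<open>0\<close> in
  \<open>Y\<close>. The only product in which \<open>a\<close> appears is \<open>x\<^sup>2 = aY\<close>, and there the claim is that
  \<open>x\<^sup>2 = aY\<close> is primitive.
\<close>

lemma comult_model_mult:
  "dlt (amult (model a) s t) = amult (mtens a) (dlt s) (dlt t)"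
proof -
  let ?m = "amult (model a)" and ?M = "amult (mtens a)"
  note A = is_algebraD(3-5)[OF is_algebra_model[of a]]
    and T = is_algebraD(3-5)[OF is_algebra_tensor[OF is_algebra_model is_algebra_model], of a a]
  define good where "good s \<longleftrightarrow> (\<forall>t. dlt (?m s t) = ?M (dlt s) (dlt t))" for s
  have good_mult: "good (?m s t)" if "good s" "good t" for s t
    using that by (simp add: good_def A T)
  have good_Y: "good (bvec (Suc 0, H4_1))"
    unfolding good_def by (intro allI dlt_Y_mult)
  have good_gen: "good (bvec (0, u))" if u: "u = H4_g \<or> u = H4_x" for u
  proof -
    have comm: "?M (dlt (bvec (0, u))) (dlt (bvec (Suc 0, H4_1))) =
        ?M (dlt (bvec (Suc 0, H4_1))) (dlt (bvec (0, u)))"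
      using u by (auto simp: h4_scal_def h4_deg_def)
    have commY: "?m (bvec (0, u)) (?m (bvec (Suc 0, H4_1)) t) =
        ?m (bvec (Suc 0, H4_1)) (?m (bvec (0, u)) t)" for t
      using u by (auto simp: A(1)[symmetric] h4_scal_def h4_deg_def)
    have *: "dlt (?m (bvec (0, u)) (bvec (n, h))) = ?M (dlt (bvec (0, u))) (dlt (bvec (n, h)))"
        for n h
    proof (induction n)
      case 0
      show ?case
        using u by (cases h) (auto simp: h4_scal_def h4_deg_def fs.scale_right_distrib)
    next
      case (Suc n)
      have "dlt (?m (bvec (0, u)) (bvec (Suc n, h))) =
          dlt (?m (bvec (Suc 0, H4_1)) (?m (bvec (0, u)) (bvec (n, h))))"
        unfolding Y_mult_bvec[of a n h, symmetric] commY ..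
      also have "\<dots> = ?M (?M (dlt (bvec (Suc 0, H4_1))) (dlt (bvec (0, u)))) (dlt (bvec (n, h)))"
        unfolding dlt_Y_mult Suc.IH T ..
      also have "\<dots> = ?M (dlt (bvec (0, u))) (dlt (bvec (Suc n, h)))"
        unfolding comm[symmetric] Y_mult_bvec[of a n h, symmetric] dlt_Y_mult T ..
      finally show ?case .
    qed
    show ?thesis
      unfolding good_def
      by (intro allI, rule klinear_eqI[where f = "\<lambda>t. dlt (?m (bvec (0, u)) t)"])
        (auto intro!: * klinear_intros klinear_comp[OF klinear_tensor_comult])
  qed
  have good_h: "good (bvec (0, h))" for h
  proof (cases h)
    case H4_1
    have "?m (bvec (0, H4_g)) (bvec (0, H4_g)) = bvec (0, H4_1)" by
        (simp add: h4_scal_def h4_deg_def)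
    then show ?thesis using good_mult[OF good_gen[of H4_g] good_gen[of H4_g]] H4_1 by simp
  next
    case H4_gx
    have "?m (bvec (0, H4_g)) (bvec (0, H4_x)) = bvec (0, H4_gx)" by
        (simp add: h4_scal_def h4_deg_def)
    then show ?thesis using good_mult[OF good_gen[of H4_g] good_gen[of H4_x]] H4_gx by simp
  qed (simp_all add: good_gen)
  have "good (bvec (n, h))" for n h
  proof (induction n)
    case (Suc n)
    then show ?case using good_mult[OF good_Y] by (metis Y_mult_bvec)
  qed (rule good_h)
  then have *: "dlt (?m (bvec i) t) = ?M (dlt (bvec i)) (dlt t)" for i
    by (cases i) (simp add: good_def)
  show ?thesis
    by (rule klinear_eqI[where f = "\<lambda>s. dlt (?m s t)"])
      (auto intro!: * klinear_intros klinear_comp[OF klinear_tensor_comult])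
qed

text \<open>
  Multiplicativity of a comultiplication is written in Sweedler notation in \<^const>\<open>is_bialgebra\<close>;
  read in the algebra \<open>L \<otimes> L\<close>, it says that \<open>\<Delta>\<close> is an algebra map, which allows arguments by
  generators.
\<close>

lemma sw2_mult_eq_tensor:
  "sw2 L x (\<lambda>x1 x2. sw2 L y (\<lambda>y1 y2. amult L x1 y1 \<otimes>\<^sub>k amult L x2 y2)) =
     amult (tensor_hopf L L) (comult L x) (comult L y)"
  by (simp add: sw2_def tensor_hopf_def)

lemma is_bialgebra_model: "is_bialgebra (model a)"
  unfolding is_bialgebra_def sw2_mult_eq_tensor
proof (intro conjI allI)
  fix x y :: "nat \<times> h4 \<Rightarrow>\<^sub>0 'a"
  have lin: "counit (model a) (v + w) = counit (model a) v + counit (model a) w"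
    "counit (model a) (smul c v) = c * counit (model a) v" "counit (model a) 0 = 0" for v w c
    by (simp_all add: lookup_add algebra_simps)
  show "counit (model a) (amult (model a) x y) = counit (model a) x * counit (model a) y"
  proof (induction x rule: vec_induct)
    case (basis s)
    obtain n h where s: "s = (n, h)" by force
    show ?case
    proof (induction y rule: vec_induct)
      case (basis t)
      obtain m h' where t: "t = (m, h')" by force
      show ?case unfolding s t
        by (cases h; cases h') (auto simp: h4_scal_def h4_deg_def lookup_single when_def)
    qed (simp_all add: lin algebra_simps del: model_simps(4))
  qed (simp_all add: lin algebra_simps del: model_simps(4))
qed (simp_all add: is_algebra_model is_coalgebra_model comult_model_mult lookup_single when_def)

text \<open>
  The anti-automorphism with \<open>Y \<mapsto> -Y\<close>, \<open>g \<mapsto> g\<close>, \<open>x \<mapsto> -gx\<close>, hence \<open>gx \<mapsto> x\<close>.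
\<close>

definition model_anti :: "(nat \<times> h4 \<Rightarrow>\<^sub>0 'k::field) \<Rightarrow> (nat \<times> h4 \<Rightarrow>\<^sub>0 'k)" where
  "model_anti = lin_ext (\<lambda>(n, h). case h of H4_1 \<Rightarrow> smul ((-1) ^ n) (bvec (n, H4_1))
     | H4_g \<Rightarrow> smul ((-1) ^ n) (bvec (n, H4_g))
     | H4_x \<Rightarrow> smul (- ((-1) ^ n)) (bvec (n, H4_gx))
     | H4_gx \<Rightarrow> smul ((-1) ^ n) (bvec (n, H4_x)))"

lemma alternating_binomial:
  "(\<Sum>k\<le>n. of_nat (n choose k) * (-1) ^ k :: 'k::comm_ring_1) = (if n = 0 then 1 else 0)"
  "(\<Sum>k\<le>n. of_nat (n choose k) * (-1) ^ (n - k) :: 'k::comm_ring_1) = (if n = 0 then 1 else 0)"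
  using binomial_ring[of "-1 :: 'k" 1 n] binomial_ring[of 1 "-1 :: 'k" n]
  by (auto simp: power_0_left)

lemma alternating_binomial_smul:
  "(\<Sum>k\<le>n. smul (of_nat (n choose k) * (-1) ^ k) v) = smul (if n = 0 then 1 else 0) v"
  "(\<Sum>k\<le>n. smul (of_nat (n choose k) * (-1) ^ (n - k)) v) = smul (if n = 0 then 1 else 0) v"
  unfolding fs.scale_sum_left[symmetric] alternating_binomial by (rule refl)+

text \<open>
  As \<open>Y\<close> is central, the convolution of the identity with the antipode at \<open>Y\<^sup>nh\<close> is an alternating
  binomial sum times the convolution at \<open>h\<close>. The latter never multiplies two odd elements, so that
  the same map is an antipode for every \<open>a\<close>.
\<close>

lemma is_antipode_model: "is_antipode (model a) model_anti"
  unfolding is_antipode_def sw2_def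
proof (intro conjI allI)
  show "klinear (model_anti :: _ \<Rightarrow> (nat \<times> h4 \<Rightarrow>\<^sub>0 'a))" by (simp add: model_anti_def klinear_lin_ext)
  have lin: "klinear (\<lambda>t. tlift F (comult (model a) t))" 
    "klinear (\<lambda>t. smul (counit (model a) t) (aone (model a)))" for F :: "_ \<Rightarrow> _ \<Rightarrow> (nat \<times> h4 \<Rightarrow>\<^sub>0 'a)"
    by (auto intro!: klinear_intros klinear_tensor_comult simp: klinear_iff lookup_add
        fs.scale_left_distrib algebra_simps)
  fix t :: "nat \<times> h4 \<Rightarrow>\<^sub>0 'a"
  note S = model_anti_def dlt_bvec_sum klinear_sum[OF klinear_tlift] h4_scal_def h4_deg_def
      lookup_single when_def
    alternating_binomial_smul
  show "tlift (\<lambda>h1 h2. amult (model a) (model_anti h1) h2) (comult (model a) t) =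
      smul (counit (model a) t) (aone (model a))"
  proof (rule klinear_eqI[OF lin])
    fix s :: "nat \<times> h4"
    obtain n h where s: "s = (n, h)" by force
    show "tlift (\<lambda>h1 h2. amult (model a) (model_anti h1) h2) (comult (model a) (bvec s)) =
      smul (counit (model a) (bvec s)) (aone (model a))"
      unfolding s by (cases h) (simp_all add: S)
  qed
  show "tlift (\<lambda>h1 h2. amult (model a) h1 (model_anti h2)) (comult (model a) t) =
      smul (counit (model a) t) (aone (model a))"
  proof (rule klinear_eqI[OF lin])
    fix s :: "nat \<times> h4"
    obtain n h where s: "s = (n, h)" by force
    show "tlift (\<lambda>h1 h2. amult (model a) h1 (model_anti h2)) (comult (model a) (bvec s)) =
      smul (counit (model a) (bvec s)) (aone (model a))"
      unfolding s by (cases h) (simp_all add: S)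
  qed
qed

lemma hopf_algebra_model: "hopf_algebra (model a)"
  using is_bialgebra_model is_antipode_model unfolding hopf_algebra_def by blast

section \<open>Isomorphisms of Hopf algebras\<close>

lemma tlift_tens_id [simp]: "tlift (\<lambda>a b. a \<otimes>\<^sub>k b) T = T"
  by (rule tensor_eqI) (auto intro!: klinear_intros)

lemma tlift_comp_tens:
  assumes "klinear f" "klinear g"
  shows "tlift (\<lambda>a b. f a \<otimes>\<^sub>k g b) (tlift (\<lambda>a b. f' a \<otimes>\<^sub>k g' b) T) =
      tlift (\<lambda>a b. f (f' a) \<otimes>\<^sub>k g (g' b)) T"
proof (rule tensor_eqI[where v = T])
  show "tlift (\<lambda>a b. f a \<otimes>\<^sub>k g b) (tlift (\<lambda>a b. f' a \<otimes>\<^sub>k g' b) (bvec (i, j))) =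
      tlift (\<lambda>a b. f (f' a) \<otimes>\<^sub>k g (g' b)) (bvec (i, j))" for i j
    using assms by (simp add: tlift_tens klinear_tens_left klinear_tens_right)
qed (auto intro!: klinear_intros)

lemma hopf_isoD:
  assumes "hopf_iso L M \<phi>"
  shows "bij \<phi>" "klinear \<phi>" "comult M (\<phi> h) = tlift (\<lambda>a b. \<phi> a \<otimes>\<^sub>k \<phi> b) (comult L h)"
    "counit M (\<phi> h) = counit L h" "\<phi> (amult L x y) = amult M (\<phi> x) (\<phi> y)" "\<phi> (aone L) = aone M"
  using assms by (auto simp: hopf_iso_def coalgebra_map_def sw2_def)

lemma hopf_isoI:
  assumes "bij \<phi>" "klinear \<phi>" "\<And>h. comult M (\<phi> h) = tlift (\<lambda>a b. \<phi> a \<otimes>\<^sub>k \<phi> b) (comult L h)"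
    "\<And>h. counit M (\<phi> h) = counit L h" "\<And>x y. \<phi> (amult L x y) = amult M (\<phi> x) (\<phi> y)"
    "\<phi> (aone L) = aone M"
  shows "hopf_iso L M \<phi>"
  using assms by (auto simp: hopf_iso_def coalgebra_map_def sw2_def)

lemma hopf_iso_id: "hopf_iso L L id"
  by (rule hopf_isoI) (auto simp: klinear_iff)

lemma hopf_iso_comp:
  assumes f: "hopf_iso L M \<phi>" and g: "hopf_iso M N \<psi>"
  shows "hopf_iso L N (\<psi> \<circ> \<phi>)"
proof (rule hopf_isoI)
  show "klinear (\<psi> \<circ> \<phi>)"
    using klinear_comp[OF hopf_isoD(2)[OF g] hopf_isoD(2)[OF f]] by (simp add: comp_def)
qed (use hopf_isoD[OF f] hopf_isoD[OF g] in \<open>auto simp: bij_comp tlift_comp_tens\<close>)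

text \<open>
  The function inverse; the usual notation for it denotes the inverse in a group here.
\<close>

abbreviation finv :: "('a \<Rightarrow> 'b) \<Rightarrow> 'b \<Rightarrow> 'a" where
  "finv \<equiv> inv_into UNIV"

lemma hopf_iso_inv:
  assumes f: "hopf_iso L M \<phi>"
  shows "hopf_iso M L (finv \<phi>)"
proof (rule hopf_isoI)
  note D = hopf_isoD[OF f]
  have s [simp]: "\<phi> (finv \<phi> y) = y" "finv \<phi> (\<phi> x) = x" for x y
    using D(1) by (auto simp: bij_is_surj surj_f_inv_f bij_is_inj inv_f_f)
  show lin: "klinear (finv \<phi>)"
    unfolding klinear_iff
  proof (intro conjI allI)
    show "finv \<phi> (x + y) = finv \<phi> x + finv \<phi> y" for x y
      using arg_cong[OF klinearD(1)[OF D(2), of "finv \<phi> x" "finv \<phi> y"], of "finv \<phi>"] by simp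
    show "finv \<phi> (smul c x) = smul c (finv \<phi> x)" for c x
      using arg_cong[OF klinearD(2)[OF D(2), of c "finv \<phi> x"], of "finv \<phi>"] by simp
  qed
  show "comult L (finv \<phi> h) = tlift (\<lambda>a b. finv \<phi> a \<otimes>\<^sub>k finv \<phi> b) (comult M h)" for h
    using arg_cong[OF D(3)[of "finv \<phi> h"], of "tlift (\<lambda>a b. finv \<phi> a \<otimes>\<^sub>k finv \<phi> b)"]
    by (simp add: tlift_comp_tens[OF lin lin])
  show "counit L (finv \<phi> h) = counit M h" for h using D(4)[of "finv \<phi> h"] by simp
  show "finv \<phi> (amult M x y) = amult L (finv \<phi> x) (finv \<phi> y)" for x y
    using arg_cong[OF D(5)[of "finv \<phi> x" "finv \<phi> y"], of "finv \<phi>"] by simp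
  show "finv \<phi> (aone M) = aone L" using arg_cong[OF D(6), of "finv \<phi>"] by simp
  show "bij (finv \<phi>)" using D(1) by (rule bij_imp_bij_inv)
qed

lemma hopf_isomorphic_sym: "L \<cong>\<^sub>H M \<Longrightarrow> M \<cong>\<^sub>H L"
  and hopf_isomorphic_trans: "L \<cong>\<^sub>H M \<Longrightarrow> M \<cong>\<^sub>H N \<Longrightarrow> L \<cong>\<^sub>H N"
  and hopf_isomorphic_refl: "L \<cong>\<^sub>H L"
  unfolding hopf_isomorphic_def using hopf_iso_inv hopf_iso_comp hopf_iso_id by blast+

text \<open>
  Conjugation by an isomorphism \<open>L \<rightarrow> M\<close> identifies the automorphism groups.
\<close>

lemma Aut_Hopf_cong:
  assumes "L \<cong>\<^sub>H M" "Aut_Hopf M \<cong> G"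
  shows "Aut_Hopf L \<cong> G"
proof -
  obtain \<phi> where f: "hopf_iso L M \<phi>" using assms(1) by (auto simp: hopf_isomorphic_def)
  have s [simp]: "\<phi> (finv \<phi> y) = y" "finv \<phi> (\<phi> x) = x" for x y
    using hopf_isoD(1)[OF f] by (auto simp: bij_is_surj surj_f_inv_f bij_is_inj inv_f_f)
  have "(\<lambda>\<psi>. \<phi> \<circ> \<psi> \<circ> finv \<phi>) \<in> iso (Aut_Hopf L) (Aut_Hopf M)"
    unfolding iso_def hom_def mem_Collect_eq
  proof (intro conjI ballI)
    show "(\<lambda>\<psi>. \<phi> \<circ> \<psi> \<circ> finv \<phi>) \<in> carrier (Aut_Hopf L) \<rightarrow> carrier (Aut_Hopf M)"
      using f by (auto simp: Aut_Hopf_def intro!: hopf_iso_comp hopf_iso_inv)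
    show "bij_betw (\<lambda>\<psi>. \<phi> \<circ> \<psi> \<circ> finv \<phi>) (carrier (Aut_Hopf L)) (carrier (Aut_Hopf M))"
      by (rule bij_betw_byWitness[where f' = "\<lambda>\<psi>. finv \<phi> \<circ> \<psi> \<circ> \<phi>"])
        (use f in \<open>auto simp: Aut_Hopf_def fun_eq_iff intro!: hopf_iso_comp hopf_iso_inv\<close>)
  qed (auto simp: Aut_Hopf_def fun_eq_iff)
  then have "Aut_Hopf L \<cong> Aut_Hopf M" by (auto simp: is_iso_def)
  then show ?thesis using assms(2) by (rule iso_trans)
qed

section \<open>Isomorphisms between the Hopf algebras with \<open>x\<^sup>2 = aY\<close>\<close>

definition rescale :: "'k::field \<Rightarrow> 'k \<Rightarrow> (nat \<times> h4 \<Rightarrow>\<^sub>0 'k) \<Rightarrow> (nat \<times> h4 \<Rightarrow>\<^sub>0 'k)" where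
  "rescale d b = lin_ext (\<lambda>(n, h). smul (d ^ n * (if h4_odd h then b else 1)) (bvec (n, h)))"

lemma klinear_rescale: "klinear (rescale d b)"
  by (simp add: rescale_def klinear_lin_ext)

lemmas rescale_linear [simp] = klinearD[OF klinear_rescale]

lemma rescale_bvec [simp]:
  "rescale d b (bvec (n, h)) = smul (d ^ n * (if h4_odd h then b else 1)) (bvec (n, h))"
  by (simp add: rescale_def)

lemma lookup_rescale:
  "coord (rescale d b t) (n, h) = d ^ n * (if h4_odd h then b else 1) * coord t (n, h)"
proof (induction t rule: vec_induct)
  case (basis s)
  then show ?case by (cases s) (auto simp: lookup_single when_def)
qed (auto simp: lookup_add algebra_simps)

lemma rescale_rescale: "rescale d b (rescale d' b' t) = rescale (d * d') (b * b') t"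
  by (rule poly_mapping_eqI) (auto simp: lookup_rescale power_mult_distrib split_paired_all)

lemma rescale_1_1 [simp]: "rescale 1 1 t = t"
  by (rule poly_mapping_eqI) (auto simp: lookup_rescale split_paired_all)

lemma lookup_tlift_rescale:
  "coord (tlift (\<lambda>s t. rescale d b s \<otimes>\<^sub>k rescale d b t) T) ((i, u), (j, v)) =
    d ^ (i + j) * (if h4_odd u then b else 1) * (if h4_odd v then b else 1) * coord T
        ((i, u), (j, v))"
proof (induction T rule: vec_induct)
  case (basis s)
  obtain n h m h' where s: "s = ((n, h), (m, h'))" by (metis surj_pair)
  show ?case unfolding s by (auto simp: lookup_single when_def power_add)
qed (auto simp: lookup_add algebra_simps)

text \<open>
  The map \<open>Y \<mapsto> dY\<close>, \<open>g \<mapsto> g\<close>, \<open>x \<mapsto> bx\<close> respects the relation \<open>x\<^sup>2 = aY\<close> iff \<open>b\<^sup>2a' = ad\<close>. So all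
  \<open>a \<noteq> 0\<close> give isomorphic Hopf algebras, over any field: \<open>Y\<close> is rescaled and no square root is
  taken.
\<close>

lemma hopf_iso_rescale:
  assumes "d \<noteq> 0" "b \<noteq> 0" and rel: "a * d = b\<^sup>2 * a'"
  shows "hopf_iso (model a) (model a') (rescale d b)"
proof (rule hopf_isoI)
  show "bij (rescale d b)"
    by (rule o_bij[where g = "rescale (1 / d) (1 / b)"])
        (use assms in \<open>auto simp: fun_eq_iff rescale_rescale\<close>)
  show "comult (model a') (rescale d b t) = tlift (\<lambda>s t. rescale d b s \<otimes>\<^sub>k rescale d b t)
      (comult (model a) t)" for t
  proof (rule poly_mapping_eqI)
    fix s :: "(nat \<times> h4) \<times> nat \<times> h4"
    obtain i u j v where s: "s = ((i, u), (j, v))" by (metis surj_pair)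
    show "coord (comult (model a') (rescale d b t)) s =
       coord (tlift (\<lambda>s t. rescale d b s \<otimes>\<^sub>k rescale d b t) (comult (model a) t)) s"
      unfolding s model_simps lookup_dlt lookup_tlift_rescale
      by (cases u; cases v) (simp_all add: lookup_rescale)
  qed
  show "rescale d b (amult (model a) s t) = amult (model a') (rescale d b s) (rescale d b t)"
      for s t
  proof (rule bilinear_eqI[where F = "\<lambda>s t. rescale d b (amult (model a) s t)"])
    fix p q :: "nat \<times> h4"
    obtain n h m h' where s: "p = (n, h)" "q = (m, h')" by (metis surj_pair)
    have rel': "a * (d * z) = b * (b * (a' * z))" for z
      using rel by (simp add: power2_eq_square mult.assoc[symmetric])
    show "rescale d b (amult (model a) (bvec p) (bvec q)) =
        amult (model a') (rescale d b (bvec p)) (rescale d b (bvec q))"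
      unfolding s by (cases h; cases h') (simp_all add: h4_scal_def h4_deg_def power_add rel'
          mult_ac)
  qed (auto intro!: klinear_intros klinear_comp[OF klinear_rescale] klinear_rescale)
qed (auto simp: klinear_rescale lookup_rescale)

text \<open>
  The coefficients of a group-like polynomial. If \<open>m > 0\<close> were the degree, then
  \<open>t\<^sub>m\<^sup>2\<close> would be a multiple of \<open>t\<^sub>2\<^sub>m = 0\<close>.
\<close>

lemma group_like_coefficients:
  fixes t :: "nat \<Rightarrow> 'k::field"
  assumes fin: "finite {n. t n \<noteq> 0}" and mul: "\<And>i j. of_nat ((i + j) choose i) * t (i + j) =
      t i * t j"
  shows "n > 0 \<Longrightarrow> t n = 0" "t 0 = 0 \<or> t 0 = 1"
proof -
  show "t 0 = 0 \<or> t 0 = 1" using mul[of 0 0] by simp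
  assume n: "n > 0"
  show "t n = 0"
  proof (rule ccontr)
    assume nz: "t n \<noteq> 0"
    define m where "m = Max {n. t n \<noteq> 0}"
    have "m \<in> {n. t n \<noteq> 0}" unfolding m_def using fin nz by (intro Max_in) auto
    moreover have "n \<le> m" unfolding m_def using fin nz by (intro Max_ge) auto
    ultimately have "t (m + m) \<noteq> 0" "m > 0" using mul[of m m] n by auto
    then have "m + m \<le> m" unfolding m_def using fin by (intro Max_ge) (auto simp: m_def)
    then show False using \<open>m > 0\<close> by simp
  qed
qed

text \<open>
  The coefficients of a primitive polynomial: comparing \<open>Y \<otimes> Y\<^sup>m\<close> gives \<open>(m + 1)t\<^sub>m\<^sub>+\<^sub>1 = 0\<close> for
  \<open>m > 0\<close>, and characteristic zero is what makes \<open>m + 1\<close> invertible.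
\<close>

lemma primitive_coefficients:
  fixes t :: "nat \<Rightarrow> 'k::field_char_0"
  assumes prim: "\<And>i j. of_nat ((i + j) choose i) * t (i + j) =
    (if j = 0 then t i else 0) + (if i = 0 then t j else 0)"
  assumes "n \<noteq> 1"
  shows "t n = 0"
proof (cases n)
  case 0
  then show ?thesis using prim[of 0 0] by simp
next
  case (Suc m)
  then have "m > 0" using assms(2) by simp
  then have "of_nat (Suc m) * t (Suc m) = 0" using prim[of 1 m] by (simp del: of_nat_Suc)
  then have "t (Suc m) = 0" by (simp only: mult_eq_0_iff of_nat_eq_0_iff nat.simps simp_thms)
  then show ?thesis using Suc by simp
qed

lemma finite_lookup_coeffs: "finite {n. coord t (f n) \<noteq> 0}" if "inj f"
proof -
  have "finite (f -` Poly_Mapping.keys t)" using that by (intro finite_vimageI) auto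
  then show ?thesis by (simp add: vimage_def in_keys_iff)
qed

text \<open>
  The coordinates at \<open>(x, x)\<close> and \<open>(gx, gx)\<close> of \<open>\<Delta>(t)\<close> vanish, so a group-like \<open>t\<close> is
  \<open>p + qg\<close> with polynomials \<open>p, q\<close>; each of them is \<open>0\<close> or \<open>1\<close>, and \<open>pq = 0\<close> from the coordinate
  at \<open>(1, g)\<close>.
\<close>

lemma group_like_dlt:
  fixes t :: "nat \<times> h4 \<Rightarrow>\<^sub>0 'k::field"
  assumes "dlt t = t \<otimes>\<^sub>k t"
  shows "t = 0 \<or> t = bvec (0, H4_1) \<or> t = bvec (0, H4_g)"
proof -
  have eq: "of_nat ((i + j) choose i) * (case h4_join u v of None \<Rightarrow> 0 | Some w \<Rightarrow> coord t (i + j, w))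
      =
      coord t (i, u) * coord t (j, v)" for i j u v
    unfolding lookup_dlt[symmetric] assms by simp
  have x: "coord t (i, H4_x) = 0" "coord t (i, H4_gx) = 0" for i
    using eq[of i i H4_x H4_x] eq[of i i H4_gx H4_gx] by simp_all
  have fin: "finite {n. coord t (n, u) \<noteq> 0}" for u
    by (intro finite_lookup_coeffs inj_onI) auto
  have mul: "of_nat ((i + j) choose i) * coord t (i + j, u) =
      coord t (i, u) * coord t (j, u)" if "u = H4_1 \<or> u = H4_g" for i j u
    using that eq[of i j u u] by auto
  have 1: "n > 0 \<Longrightarrow> coord t (n, H4_1) = 0"
    "coord t (0, H4_1) = 0 \<or> coord t (0, H4_1) = 1" for n
    using group_like_coefficients[OF fin mul, of H4_1] by blast+
  have g: "n > 0 \<Longrightarrow> coord t (n, H4_g) = 0"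
    "coord t (0, H4_g) = 0 \<or> coord t (0, H4_g) = 1" for n
    using group_like_coefficients[OF fin mul, of H4_g] by blast+
  have not_both: "coord t (0, H4_1) = 0 \<or> coord t (0, H4_g) = 0"
    using eq[of 0 0 H4_1 H4_g] by simp
  have "t = smul (coord t (0, H4_1)) (bvec (0, H4_1)) + smul (coord t (0, H4_g)) (bvec (0, H4_g))"
  proof (rule poly_mapping_eqI)
    fix s :: "nat \<times> h4"
    obtain n h where s: "s = (n, h)" by force
    show "coord t s = coord (smul (coord t (0, H4_1)) (bvec (0, H4_1)) +
        smul (coord t (0, H4_g)) (bvec (0, H4_g))) s"
      unfolding s using 1(1)[of n] g(1)[of n]
      by (cases h; cases n) (simp_all add: x lookup_add lookup_single when_def)
  qed
  then show ?thesis using 1(2) g(2) not_both by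
      (metis add_0 add.right_neutral fs.scale_one fs.scale_zero_left)
qed

lemma skew_primitive_dlt:
  fixes t :: "nat \<times> h4 \<Rightarrow>\<^sub>0 'k::field_char_0"
  assumes "dlt t = t \<otimes>\<^sub>k bvec (0, H4_1) + bvec (0, H4_g) \<otimes>\<^sub>k t"
  shows "\<exists>c b. t = smul c (bvec (0, H4_1) - bvec (0, H4_g)) + smul b (bvec (0, H4_x))"
proof -
  have eq: "of_nat ((i + j) choose i) * (case h4_join u v of None \<Rightarrow> 0 | Some w \<Rightarrow> coord t (i + j, w))
      =
      (if j = 0 \<and> v = H4_1 then coord t (i, u) else 0) +
      (if i = 0 \<and> u = H4_g then coord t (j, v) else 0)" for i j u v
    unfolding lookup_dlt[symmetric] assms by (auto simp: lookup_add lookup_single when_def)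
  define c where "c = coord t (0, H4_1)"
  define b where "b = coord t (0, H4_x)"
  have "t = smul c (bvec (0, H4_1) - bvec (0, H4_g)) + smul b (bvec (0, H4_x))"
  proof (rule poly_mapping_eqI)
    fix s :: "nat \<times> h4"
    obtain n h where s: "s = (n, h)" by force
    show "coord t s = coord (smul c (bvec (0, H4_1) - bvec (0, H4_g)) + smul b (bvec (0, H4_x))) s"
      unfolding s using eq[of 0 n H4_1 H4_1] eq[of n 0 H4_g H4_g] eq[of 0 n H4_1 H4_gx]
          eq[of 0 n H4_x H4_1] eq[of 0 0 H4_g H4_1]
      by (cases h; cases "n = 0") (auto simp: c_def b_def lookup_add lookup_minus lookup_single
          when_def add_eq_0_iff2)
  qed
  then show ?thesis by blast
qed

lemma primitive_dlt:
  fixes t :: "nat \<times> h4 \<Rightarrow>\<^sub>0 'k::field_char_0"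
  assumes "dlt t = t \<otimes>\<^sub>k bvec (0, H4_1) + bvec (0, H4_1) \<otimes>\<^sub>k t"
  shows "\<exists>d. t = smul d (bvec (1, H4_1))"
proof -
  have eq: "of_nat ((i + j) choose i) * (case h4_join u v of None \<Rightarrow> 0 | Some w \<Rightarrow> coord t (i + j, w))
      =
      (if j = 0 \<and> v = H4_1 then coord t (i, u) else 0) +
      (if i = 0 \<and> u = H4_1 then coord t (j, v) else 0)" for i j u v
    unfolding lookup_dlt[symmetric] assms by (auto simp: lookup_add lookup_single when_def)
  have 1: "coord t (n, H4_1) = 0" if "n \<noteq> 1" for n
    using primitive_coefficients[of "\<lambda>n. coord t (n, H4_1)" n] eq[of _ _ H4_1 H4_1] that by simp
  have "t = smul (coord t (1, H4_1)) (bvec (1, H4_1))"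
  proof (rule poly_mapping_eqI)
    fix s :: "nat \<times> h4"
    obtain n h where s: "s = (n, h)" by force
    show "coord t s = coord (smul (coord t (1, H4_1)) (bvec (1, H4_1))) s"
      unfolding s using 1[of n] eq[of n 0 H4_g H4_1] eq[of 0 n H4_g H4_x] eq[of n 0 H4_gx H4_1]
      by (cases h; cases "n = 1") (auto simp: lookup_add lookup_single when_def)
  qed
  then show ?thesis by blast
qed

text \<open>
  An isomorphism permutes the group-likes, so it fixes \<open>g\<close>. Hence it sends \<open>x\<close> to a
  \<open>(1,g)\<close>-primitive \<open>c(1 - g) + bx\<close>, where \<open>xg = - gx\<close> forces \<open>c = 0\<close>, and \<open>Y\<close> to a primitive
  element \<open>dY\<close>; finally \<open>x\<^sup>2 = aY\<close> relates \<open>d\<close> and \<open>b\<close>.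
\<close>

lemma hopf_iso_model_cases:
  fixes a a' :: "'k::field_char_0"
  assumes f: "hopf_iso (model a) (model a') \<phi>"
  obtains d b where "d \<noteq> 0" "b \<noteq> 0" "a * d = b\<^sup>2 * a'" "\<phi> = rescale d b"
proof -
  note D = hopf_isoD[OF f] and L = klinearD[OF hopf_isoD(2)[OF f]]
  have inj: "\<phi> s = \<phi> t \<longleftrightarrow> s = t" for s t using D(1) by (simp add: bij_is_inj inj_eq)
  let ?G = "bvec (0, H4_g) :: nat \<times> h4 \<Rightarrow>\<^sub>0 'k" and ?X = "bvec (0, H4_x) :: nat \<times> h4 \<Rightarrow>\<^sub>0 'k"
    and ?Y = "bvec (Suc 0, H4_1) :: nat \<times> h4 \<Rightarrow>\<^sub>0 'k" and ?I = "bvec (0, H4_1) :: nat \<times> h4 \<Rightarrow>\<^sub>0 'k"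
  have bvec_inj: "bvec s = (bvec t :: nat \<times> h4 \<Rightarrow>\<^sub>0 'k) \<longleftrightarrow> s = t" for s t
    by (metis lookup_single_eq lookup_single_not_eq zero_neq_one)
  have bvec_nz: "bvec s \<noteq> (0 :: nat \<times> h4 \<Rightarrow>\<^sub>0 'k)" for s
    by (metis lookup_single_eq lookup_zero zero_neq_one)
  have one: "\<phi> ?I = ?I" using D(6) by simp
  have G: "\<phi> ?G = ?G"
  proof -
    have "dlt (\<phi> ?G) = \<phi> ?G \<otimes>\<^sub>k \<phi> ?G" using D(3)[of ?G] by simp
    from group_like_dlt[OF this] show ?thesis
      using inj[of ?G 0] inj[of ?G ?I] by (auto simp: L one bvec_inj bvec_nz)
  qed
  have "dlt (\<phi> ?X) = \<phi> ?X \<otimes>\<^sub>k ?I + ?G \<otimes>\<^sub>k \<phi> ?X" using D(3)[of ?X] by (simp add: one G)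
  from skew_primitive_dlt[OF this] obtain c b where X0: "\<phi> ?X = smul c (?I - ?G) + smul b ?X" by
      blast
  have "amult (model a') (\<phi> ?X) (\<phi> ?G) = - amult (model a') (\<phi> ?G) (\<phi> ?X)"
    unfolding D(5)[symmetric] by (simp add: h4_scal_def h4_deg_def L)
  then have "amult (model a') (\<phi> ?X) ?G = - amult (model a') ?G (\<phi> ?X)"
    unfolding G .
  \<comment> \<open>The coordinate at \<open>g\<close> of \<open>xg = - gx\<close>.\<close>
  from arg_cong[OF this, of "\<lambda>t. coord t (0, H4_g)"] have "c = - c"
    by (simp add: X0 h4_scal_def h4_deg_def lookup_add lookup_minus lookup_single when_def)
  then have "2 * c = 0" by simp
  then have "c = 0" by simp
  with X0 have X: "\<phi> ?X = smul b ?X" by simp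
  have "dlt (\<phi> ?Y) = \<phi> ?Y \<otimes>\<^sub>k ?I + ?I \<otimes>\<^sub>k \<phi> ?Y" using D(3)[of ?Y] by (simp add: one)
  from primitive_dlt[OF this] obtain d where Y: "\<phi> ?Y = smul d ?Y" by auto
  have b: "b \<noteq> 0" using inj[of ?X 0] X by (auto simp: L bvec_nz)
  have d: "d \<noteq> 0" using inj[of ?Y 0] Y by (auto simp: L bvec_nz)
  \<comment> \<open>The image of the relation \<open>x\<^sup>2 = aY\<close>.\<close>
  have "\<phi> (amult (model a) ?X ?X) = amult (model a') (\<phi> ?X) (\<phi> ?X)" by (rule D(5))
  then have "smul (a * d) ?Y = smul (b * b * a') ?Y"
    by (simp add: X Y h4_scal_def h4_deg_def L mult_ac)
  from arg_cong[OF this, of "\<lambda>t. coord t (Suc 0, H4_1)"]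
  have rel: "a * d = b\<^sup>2 * a'" by (simp add: power2_eq_square)
  note R = hopf_isoD[OF hopf_iso_rescale[OF d b rel]]
  have *: "\<phi> (bvec (0, h)) = rescale d b (bvec (0, h))" for h
  proof (cases h)
    case H4_gx
    have gx: "bvec (0, H4_gx) = amult (model a) ?G ?X" by (simp add: h4_scal_def h4_deg_def)
    show ?thesis unfolding H4_gx gx D(5) R(5) by (simp add: G X)
  qed (simp_all add: one G X)
  have "\<phi> (bvec (n, h)) = rescale d b (bvec (n, h))" for n h
  proof (induction n)
    case (Suc n)
    show ?case unfolding Y_mult_bvec[of a n h, symmetric] D(5) R(5) Suc.IH by (simp add: Y)
  qed (rule *)
  then have "\<phi> t = rescale d b t" for t
    by (rule tensor_eqI[OF D(2) klinear_rescale])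
  then show ?thesis using that d b rel by blast
qed

section \<open>Automorphism groups\<close>

lemma Aut_Hopf_simps:
  "carrier (Aut_Hopf L) = {\<phi>. hopf_iso L L \<phi>}" "\<phi> \<otimes>\<^bsub>Aut_Hopf L\<^esub> \<psi> = \<phi> \<circ> \<psi>"
  by (simp_all add: Aut_Hopf_def)

lemma field_units_simps: "carrier field_units = UNIV - {0}" "x \<otimes>\<^bsub>field_units\<^esub> y = x * y"
  by (simp_all add: field_units_def)

lemma rescale_comp: "rescale d b \<circ> rescale d' b' = rescale (d * d') (b * b')"
  by (simp add: fun_eq_iff rescale_rescale)

text \<open>
  The factors by which an automorphism rescales \<open>Y\<close> and \<open>x\<close>; these are the coordinates on the
  automorphism groups. For \<open>a = 0\<close> they are independent, while \<open>x\<^sup>2 = aY\<close> with \<open>a \<noteq> 0\<close> makes the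
  first the square of the second.
\<close>

definition Y_factor :: "((nat \<times> h4 \<Rightarrow>\<^sub>0 'k::field) \<Rightarrow> (nat \<times> h4 \<Rightarrow>\<^sub>0 'k)) \<Rightarrow> 'k" where
  "Y_factor \<phi> = coord (\<phi> (bvec (1, H4_1))) (1, H4_1)"

definition x_factor :: "((nat \<times> h4 \<Rightarrow>\<^sub>0 'k::field) \<Rightarrow> (nat \<times> h4 \<Rightarrow>\<^sub>0 'k)) \<Rightarrow> 'k" where
  "x_factor \<phi> = coord (\<phi> (bvec (0, H4_x))) (0, H4_x)"

lemma factor_rescale [simp]: "Y_factor (rescale d b) = d" "x_factor (rescale d b) = b"
  by (simp_all add: Y_factor_def x_factor_def)

lemma Aut_model:
  fixes a :: "'k::field_char_0"
  shows "carrier (Aut_Hopf (model a)) = {rescale d b | d b. d \<noteq> 0 \<and> b \<noteq> 0 \<and> a * d = b\<^sup>2 * a}"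
proof (intro equalityI subsetI)
  fix \<phi> assume "\<phi> \<in> carrier (Aut_Hopf (model a))"
  then have "hopf_iso (model a) (model a) \<phi>" by (simp add: Aut_Hopf_simps)
  then show "\<phi> \<in> {rescale d b | d b. d \<noteq> 0 \<and> b \<noteq> 0 \<and> a * d = b\<^sup>2 * a}"
    by (rule hopf_iso_model_cases) blast
qed (auto simp: Aut_Hopf_simps intro: hopf_iso_rescale)

lemma Aut_model_0: "Aut_Hopf (model (0 :: 'k::field_char_0)) \<cong> (field_units :: 'k monoid) \<times>\<times>
    (field_units :: 'k monoid)"
proof -
  have "(\<lambda>\<phi>. (Y_factor \<phi>, x_factor \<phi>)) \<in> iso (Aut_Hopf (model (0::'k)))
      ((field_units :: 'k monoid) \<times>\<times> (field_units :: 'k monoid))"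
    unfolding iso_def hom_def mem_Collect_eq
  proof (intro conjI ballI)
    show "bij_betw (\<lambda>\<phi>. (Y_factor \<phi>, x_factor \<phi>)) (carrier (Aut_Hopf (model (0::'k))))
        (carrier (field_units \<times>\<times> field_units))"
      by (rule bij_betw_byWitness[where f' = "\<lambda>(d, b). rescale d b"])
        (auto simp: Aut_model field_units_simps)
  qed (auto simp: Aut_model Aut_Hopf_simps(2) field_units_simps rescale_comp)
  then show ?thesis by (auto simp: is_iso_def)
qed

lemma Aut_model_1: "Aut_Hopf (model (1 :: 'k::field_char_0)) \<cong> (field_units :: 'k monoid)"
proof -
  have "x_factor \<in> iso (Aut_Hopf (model (1::'k))) field_units"
    unfolding iso_def hom_def mem_Collect_eq
  proof (intro conjI ballI)
    show "bij_betw x_factor (carrier (Aut_Hopf (model (1::'k)))) (carrier field_units)"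
      by (rule bij_betw_byWitness[where f' = "\<lambda>b. rescale (b\<^sup>2) b"])
        (auto simp: Aut_model field_units_simps)
  qed (auto simp: Aut_model Aut_Hopf_simps(2) field_units_simps rescale_comp)
  then show ?thesis by (auto simp: is_iso_def)
qed

lemma model_isomorphic_1:
  assumes "a \<noteq> 0"
  shows "model a \<cong>\<^sub>H model 1"
  using hopf_iso_rescale[of "1 / a" 1 a 1] assms by (auto simp: hopf_isomorphic_def)

lemma model_0_not_isomorphic_1: "\<not> model (0 :: 'k::field_char_0) \<cong>\<^sub>H model 1"
proof
  assume "model (0 :: 'k) \<cong>\<^sub>H model 1"
  then obtain \<phi> where "hopf_iso (model (0 :: 'k)) (model 1) \<phi>" by (auto simp: hopf_isomorphic_def)
  then show False by (rule hopf_iso_model_cases) simp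
qed

section \<open>Presentations\<close>

lemma free_eval_simps:
  "klinear (free_eval L \<phi>)" "free_eval L \<phi> (bvec u) = foldr (\<lambda>s. amult L (\<phi> s)) u (aone L)"
  by (simp_all add: free_eval_def klinear_lin_ext)

lemmas free_eval_linear [simp] = klinearD[OF free_eval_simps(1)]

lemma klinear_free_mult [klinear_intros]:
  "klinear f \<Longrightarrow> klinear (\<lambda>q. amult free_algebra p (f q))"
  "klinear f \<Longrightarrow> klinear (\<lambda>p. amult free_algebra (f p) q)"
  by (auto simp: free_algebra_def intro!: klinear_intros)

lemmas free_mult_linear [simp] = klinearD[OF klinear_free_mult(1)[OF klinear_id]]
  klinearD[OF klinear_free_mult(2)[OF klinear_id]]

lemma free_mult_bvec [simp]: "amult free_algebra (bvec u) (bvec v) = bvec (u @ v)"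
  by (simp add: free_algebra_def)

lemma free_eval_mult:
  assumes "is_algebra L"
  shows "free_eval L \<phi> (amult free_algebra p q) = amult L (free_eval L \<phi> p) (free_eval L \<phi> q)"
proof (rule bilinear_eqI[where F = "\<lambda>p q. free_eval L \<phi> (amult free_algebra p q)"])
  note A = is_algebraD[OF assms]
  show "free_eval L \<phi> (amult free_algebra (bvec u) (bvec v)) =
      amult L (free_eval L \<phi> (bvec u)) (free_eval L \<phi> (bvec v))" for u v
    by (induction u) (simp_all add: free_eval_simps A)
qed (auto intro!: klinear_intros klinear_comp[OF free_eval_simps(1)] is_algebraD(1,2)[OF assms]
    free_eval_simps(1))

lemma two_sided_ideal_gen: "two_sided_ideal L (ideal_gen L R)"
  unfolding two_sided_ideal_def ideal_gen_def fs.subspace_def by blast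

lemma ideal_gen_superset: "R \<subseteq> ideal_gen L R"
  unfolding ideal_gen_def by blast

lemma ideal_gen_least: "two_sided_ideal L I \<Longrightarrow> R \<subseteq> I \<Longrightarrow> ideal_gen L R \<subseteq> I"
  unfolding ideal_gen_def by blast

lemma two_sided_ideal_kernel:
  assumes "is_algebra L"
  shows "two_sided_ideal free_algebra {p. free_eval L \<phi> p = 0}"
proof -
  have z: "amult L x 0 = 0" "amult L 0 x = 0" for x
    using klinearD(3)[OF is_algebraD(1)[OF assms klinear_id]]
        klinearD(3)[OF is_algebraD(2)[OF assms klinear_id]] by auto
  show ?thesis
    unfolding two_sided_ideal_def fs.subspace_def by (simp add: free_eval_mult[OF assms] z)
qed

lemma tlift_tens_hom_mult:
  assumes "is_algebra L" "is_algebra M" and lin: "klinear \<phi>" and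
      mult: "\<And>x y. \<phi> (amult L x y) = amult M (\<phi> x) (\<phi> y)"
  shows "tlift (\<lambda>a b. \<phi> a \<otimes>\<^sub>k \<phi> b) (amult (tensor_hopf L L) S T) =
    amult (tensor_hopf M M) (tlift (\<lambda>a b. \<phi> a \<otimes>\<^sub>k \<phi> b) S) (tlift (\<lambda>a b. \<phi> a \<otimes>\<^sub>k \<phi> b) T)"
proof (rule bilinear_eqI[where F = "\<lambda>S T. tlift (\<lambda>a b. \<phi> a \<otimes>\<^sub>k \<phi> b) (amult (tensor_hopf L L) S T)"])
  fix p q :: "'a \<times> 'a"
  obtain i j i' j' where s: "p = (i, j)" "q = (i', j')" by (metis surj_pair)
  show "tlift (\<lambda>a b. \<phi> a \<otimes>\<^sub>k \<phi> b) (amult (tensor_hopf L L) (bvec p) (bvec q)) =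
    amult (tensor_hopf M M) (tlift (\<lambda>a b. \<phi> a \<otimes>\<^sub>k \<phi> b) (bvec p))
        (tlift (\<lambda>a b. \<phi> a \<otimes>\<^sub>k \<phi> b) (bvec q))"
    unfolding s using lin
    by (simp add: tlift_tens klinear_tens_left klinear_tens_right mult
        amult_tensor_tens[OF assms(2,2)])
qed (auto intro!: klinear_intros)

lemma is_bialgebraD:
  assumes "is_bialgebra L"
  shows "is_algebra L" "klinear (comult L)" "Vector_Spaces.linear smul (*) (counit L)"
    "comult L (amult L x y) = amult (tensor_hopf L L) (comult L x) (comult L y)"
    "comult L (aone L) = aone L \<otimes>\<^sub>k aone L" "counit L (amult L x y) = counit L x * counit L y"
        "counit L (aone L) = 1"
    "sw2 L h (\<lambda>h1 h2. smul (counit L h1) h2) = h"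
  using assms by (auto simp: is_bialgebra_def is_coalgebra_def sw2_mult_eq_tensor)

lemma counitD:
  assumes "is_bialgebra L"
  shows "counit L (v + w) = counit L v + counit L w" "counit L (smul c v) = c * counit L v"
      "counit L 0 = 0"
proof -
  interpret Vector_Spaces.linear smul "(*)" "counit L" by (rule is_bialgebraD(3)[OF assms])
  show "counit L (v + w) = counit L v + counit L w" "counit L (smul c v) = c * counit L v"
      "counit L 0 = 0"
    by (simp_all add: add scale zero)
qed

lemma klinear_counit_left:
  assumes "is_bialgebra L"
  shows "klinear (\<lambda>x. smul (counit L x) y)"
  by (simp add: klinear_iff counitD[OF assms] fs.scale_left_distrib)

lemma counit_group_like:
  assumes "is_bialgebra L" "group_like L g"
  shows "counit L g = 1"
proof -
  have "tlift (\<lambda>h1 h2. smul (counit L h1) h2) (g \<otimes>\<^sub>k g) = g"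
    using is_bialgebraD(8)[OF assms(1), of g] assms(2) by (simp add: sw2_def group_like_def)
  then have "smul (counit L g) g = g"
    by (subst (asm) tlift_tens) (auto intro!: klinear_intros klinear_counit_left assms(1))
  then have "smul (counit L g - 1) g = 0" by (simp add: fs.scale_left_diff_distrib)
  then show ?thesis using assms(2) by (simp add: group_like_def)
qed

lemma counit_skew_primitive:
  assumes "is_bialgebra L" "group_like L g" "skew_primitive L g x"
  shows "counit L x = 0"
proof -
  have *: "tlift (\<lambda>h1 h2. smul (counit L h1) h2) (x \<otimes>\<^sub>k aone L + g \<otimes>\<^sub>k x) = x"
    using is_bialgebraD(8)[OF assms(1), of x] assms(3) by (simp add: sw2_def skew_primitive_def)
  have **: "tlift (\<lambda>h1 h2. smul (counit L h1) h2) (v \<otimes>\<^sub>k w) = smul (counit L v) w" for v w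
    by (subst tlift_tens) (auto intro!: klinear_intros klinear_counit_left assms(1))
  have "smul (counit L x) (aone L) + x = x"
    using * unfolding tlift_linear(1) ** counit_group_like[OF assms(1,2)] by simp
  then have "smul (counit L x) (aone L) = 0" by (simp only: add_0_iff add_cancel_left_left)
  then have "counit L x * counit L (aone L) = 0"
    by (metis counitD(2,3)[OF assms(1)])
  then show ?thesis by (simp add: is_bialgebraD(7)[OF assms(1)])
qed

text \<open>
  Both sides of each equation are algebra maps in \<open>h\<close>, because \<open>\<Delta>\<close>, \<open>\<epsilon>\<close>, \<open>\<phi>\<close> and \<open>\<phi> \<otimes> \<phi>\<close> are;
  induction on words in the generators therefore suffices.
\<close>

lemma coalgebra_hom_on_generators:
  assumes L: "is_bialgebra L" and M: "is_bialgebra M" and lin: "klinear \<phi>"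
    and mult: "\<And>x y. \<phi> (amult L x y) = amult M (\<phi> x) (\<phi> y)" and one: "\<phi> (aone L) = aone M"
    and gens: "surj (free_eval L \<gamma>)"
    and \<Delta>: "\<And>s. comult M (\<phi> (\<gamma> s)) = tlift (\<lambda>a b. \<phi> a \<otimes>\<^sub>k \<phi> b) (comult L (\<gamma> s))"
    and \<epsilon>: "\<And>s. counit M (\<phi> (\<gamma> s)) = counit L (\<gamma> s)"
  shows "comult M (\<phi> h) = tlift (\<lambda>a b. \<phi> a \<otimes>\<^sub>k \<phi> b) (comult L h)" "counit M (\<phi> h) = counit L h"
proof -
  note DL = is_bialgebraD[OF L] and DM = is_bialgebraD[OF M]
  obtain p where p: "h = free_eval L \<gamma> p" using gens by (metis surjD)
  have w\<Delta>: "comult M (\<phi> (free_eval L \<gamma> (bvec u))) =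
      tlift (\<lambda>a b. \<phi> a \<otimes>\<^sub>k \<phi> b) (comult L (free_eval L \<gamma> (bvec u)))"
    for u
  proof (induction u)
    case Nil
    show ?case using lin
      by (simp add: free_eval_simps one DM DL tlift_tens klinear_tens_left klinear_tens_right)
  next
    case (Cons s u)
    then show ?case
      by (simp add: free_eval_simps mult DM(4) DL(4) \<Delta> tlift_tens_hom_mult[OF DL(1) DM(1) lin mult])
  qed
  have w\<epsilon>: "counit M (\<phi> (free_eval L \<gamma> (bvec u))) = counit L (free_eval L \<gamma> (bvec u))" for u
    by (induction u) (simp_all add: free_eval_simps one mult DM(6,7) DL(6,7) \<epsilon>)
  show "comult M (\<phi> h) = tlift (\<lambda>a b. \<phi> a \<otimes>\<^sub>k \<phi> b) (comult L h)"
    unfolding p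
    by (rule klinear_eqI[where f = "\<lambda>p. comult M (\<phi> (free_eval L \<gamma> p))"])
      (auto intro!: klinear_comp[OF DM(2)] klinear_comp[OF DL(2)] klinear_comp[OF lin]
          klinear_intros free_eval_simps(1) w\<Delta>)
  show "counit M (\<phi> h) = counit L h"
    unfolding p by (induction p rule: vec_induct)
      (simp_all add: counitD[OF L] counitD[OF M] klinearD[OF lin] w\<epsilon>)
qed

text \<open>
  Two algebras with the same presentation are identified by evaluating the free algebra in each of
  them. The identification respects the coalgebra structures on \<open>g\<close> and \<open>x\<close>, where \<open>\<Delta>\<close> is
  prescribed and \<open>\<epsilon>\<close> is determined by the counit axiom.
\<close>

lemma is_A_infinity_unique:
  assumes L: "is_A_infinity L g x" and M: "is_A_infinity M g' x'"
  shows "L \<cong>\<^sub>H M"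
proof -
  let ?\<gamma> = "case_gen g x" and ?\<delta> = "case_gen g' x'"
  have L': "is_bialgebra L" "surj (free_eval L ?\<gamma>)" "group_like L g" "skew_primitive L g x"
    and M': "is_bialgebra M" "surj (free_eval M ?\<delta>)" "group_like M g'" "skew_primitive M g' x'"
    using L M by (auto simp: is_A_infinity_def hopf_algebra_def presented_by_def)
  have "{p. free_eval L ?\<gamma> p = 0} = {p. free_eval M ?\<delta> p = 0}"
    using L M by (simp add: is_A_infinity_def presented_by_def)
  then have ker: "free_eval L ?\<gamma> p = 0 \<longleftrightarrow> free_eval M ?\<delta> p = 0" for p by blast
  have eq: "free_eval L ?\<gamma> p = free_eval L ?\<gamma> q \<longleftrightarrow> free_eval M ?\<delta> p = free_eval M ?\<delta> q" for p q
    using ker[of "p - q"] by simp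
  note DL = is_bialgebraD[OF L'(1)] and DM = is_bialgebraD[OF M'(1)]
  define \<phi> where "\<phi> y = free_eval M ?\<delta> (finv (free_eval L ?\<gamma>) y)" for y
  have \<phi>: "\<phi> (free_eval L ?\<gamma> p) = free_eval M ?\<delta> p" for p
    unfolding \<phi>_def using eq by (metis L'(2) surj_f_inv_f)
  have ex: "\<exists>p. y = free_eval L ?\<gamma> p" for y using L'(2) by (metis surjD)
  have lin: "klinear \<phi>"
    unfolding klinear_iff
  proof (intro conjI allI)
    fix y z c
    obtain p q where "y = free_eval L ?\<gamma> p" "z = free_eval L ?\<gamma> q" using ex by metis
    then show "\<phi> (y + z) = \<phi> y + \<phi> z" "\<phi> (smul c y) = smul c (\<phi> y)"
      by (metis \<phi> free_eval_linear(1), metis \<phi> free_eval_linear(2))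
  qed
  have mult: "\<phi> (amult L y z) = amult M (\<phi> y) (\<phi> z)" for y z
  proof -
    obtain p q where "y = free_eval L ?\<gamma> p" "z = free_eval L ?\<gamma> q" using ex by metis
    then show ?thesis by (metis \<phi> free_eval_mult DL(1) DM(1))
  qed
  have one: "\<phi> (aone L) = aone M" using \<phi>[of "bvec []"] by (simp add: free_eval_simps)
  have gen: "\<phi> (?\<gamma> s) = ?\<delta> s" for s
    using \<phi>[of "bvec [s]"] by (simp add: free_eval_simps is_algebraD(5)[OF DL(1)]
        is_algebraD(5)[OF DM(1)])
  have gens: "\<phi> g = g'" "\<phi> x = x'" using gen[of gen_g] gen[of gen_x] by simp_all
  have T: "tlift (\<lambda>a b. \<phi> a \<otimes>\<^sub>k \<phi> b) (v \<otimes>\<^sub>k w) = \<phi> v \<otimes>\<^sub>k \<phi> w" for v w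
    using lin by (simp add: tlift_tens klinear_tens_left klinear_tens_right)
  have \<Delta>: "comult M (\<phi> (?\<gamma> s)) = tlift (\<lambda>a b. \<phi> a \<otimes>\<^sub>k \<phi> b) (comult L (?\<gamma> s))" for s
    using L'(3,4) M'(3,4) by (cases s) (simp_all add: gens group_like_def skew_primitive_def T one)
  have \<epsilon>: "counit M (\<phi> (?\<gamma> s)) = counit L (?\<gamma> s)" for s
    by (cases s) (simp_all add: gens counit_group_like[OF L'(1,3)] counit_group_like[OF M'(1,3)]
        counit_skew_primitive[OF L'(1,3,4)] counit_skew_primitive[OF M'(1,3,4)])
  have "hopf_iso L M \<phi>"
  proof (rule hopf_isoI)
    show "bij \<phi>"
    proof (rule bijI)
      show "inj \<phi>" by (rule injI) (metis ex \<phi> eq)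
      show "surj \<phi>" by (rule surjI[where f = "\<lambda>z. free_eval L ?\<gamma> (finv (free_eval M ?\<delta>) z)"])
        (simp add: \<phi> surj_f_inv_f[OF M'(2)])
    qed
  qed (rule lin one mult coalgebra_hom_on_generators[OF L'(1) M'(1) lin mult one L'(2) \<Delta> \<epsilon>])+
  then show ?thesis by (auto simp: hopf_isomorphic_def)
qed

text \<open>
  As \<open>Y = x\<^sup>2\<close> in the Hopf algebra with \<open>a = 1\<close>, its basis consists of the words
  \<open>g\<^sup>ix\<^sup>m\<close> with \<open>i \<le> 1\<close>, which are the normal forms for the relations of \<open>A\<^sub>(\<^sub>\<infinity>\<^sub>)\<close>.
\<close>

fun normal_word :: "nat \<times> h4 \<Rightarrow> gen list" where
  "normal_word (n, H4_1) = replicate (2 * n) gen_x"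
| "normal_word (n, H4_g) = gen_g # replicate (2 * n) gen_x"
| "normal_word (n, H4_x) = replicate (Suc (2 * n)) gen_x"
| "normal_word (n, H4_gx) = gen_g # replicate (Suc (2 * n)) gen_x"

abbreviation "model_gen \<equiv> case_gen (bvec (0, H4_g)) (bvec (0, H4_x)) :: gen \<Rightarrow>
    (nat \<times> h4 \<Rightarrow>\<^sub>0 'k::field)"

lemma foldr_x:
  "foldr (\<lambda>s. amult (model 1) (model_gen s)) (replicate (2 * n) gen_x) (bvec (0, H4_1)) =
      bvec (n, H4_1)"
  by (induction n) (simp_all add: h4_scal_def h4_deg_def)

lemma free_eval_normal_word: "free_eval (model 1) model_gen (bvec (normal_word s)) = bvec s"
  by (cases s rule: normal_word.cases) (simp_all add: free_eval_simps foldr_x h4_scal_def h4_deg_def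
      del: foldr_replicate)

definition normal_form :: "(nat \<times> h4 \<Rightarrow>\<^sub>0 'k::field) \<Rightarrow> (gen list \<Rightarrow>\<^sub>0 'k)" where
  "normal_form = lin_ext (\<lambda>s. bvec (normal_word s))"

lemma normal_form_simps [simp]: "normal_form (bvec s) = bvec (normal_word s)"
  by (simp add: normal_form_def)

lemma klinear_normal_form [klinear_intros]: "klinear f \<Longrightarrow> klinear (\<lambda>x. normal_form (f x))"
  by (auto simp: normal_form_def intro!: klinear_intros)

lemmas normal_form_linear [simp] = klinearD[OF klinear_normal_form[OF klinear_id]]

lemma free_eval_normal_form: "free_eval (model 1) model_gen (normal_form t) = t"
  by (rule klinear_eqI[where f = "\<lambda>t. free_eval (model 1) model_gen (normal_form t)"])
    (auto intro!: klinear_comp[OF free_eval_simps(1)] klinear_intros simp: free_eval_normal_word)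

abbreviation A_inf_relations :: "(gen list \<Rightarrow>\<^sub>0 'k::field) set" where
  "A_inf_relations \<equiv> {bvec [gen_g, gen_g] - bvec [], bvec [gen_x, gen_g] + bvec [gen_g, gen_x]}"

text \<open>
  Modulo the relations, every word is congruent to the normal form of its value: prefixing a letter
  to a normal word takes at most one relation to restore the normal form. An element of the kernel
  is hence congruent to \<open>0\<close>.
\<close>

lemma model_1_kernel:
  "{p. free_eval (model (1::'k::field)) model_gen p = 0} = ideal_gen free_algebra A_inf_relations"
proof (rule antisym)
  show "ideal_gen free_algebra A_inf_relations \<subseteq> {p. free_eval (model (1::'k)) model_gen p = 0}"
    by (rule ideal_gen_least[OF two_sided_ideal_kernel[OF is_algebra_model]])
      (simp add: free_eval_simps h4_scal_def h4_deg_def)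
  let ?I = "ideal_gen free_algebra A_inf_relations :: (gen list \<Rightarrow>\<^sub>0 'k) set"
  have I: "0 \<in> ?I" "\<And>p q. p \<in> ?I \<Longrightarrow> q \<in> ?I \<Longrightarrow> p + q \<in> ?I" "\<And>c p. p \<in> ?I \<Longrightarrow> smul c p \<in> ?I"
    "\<And>p q. q \<in> ?I \<Longrightarrow> amult free_algebra p q \<in> ?I" "\<And>p q. q \<in> ?I \<Longrightarrow> amult free_algebra q p \<in> ?I"
    using two_sided_ideal_gen[of free_algebra "A_inf_relations :: (gen list \<Rightarrow>\<^sub>0 'k) set"]
    by (auto simp: two_sided_ideal_def fs.subspace_def)
  have Rg: "bvec (gen_g # gen_g # w) - bvec w \<in> ?I" for w
    using I(5)[of "bvec [gen_g, gen_g] - bvec []" "bvec w"]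
        ideal_gen_superset[of "A_inf_relations :: (gen list \<Rightarrow>\<^sub>0 'k) set" free_algebra] by simp
  have Rx: "bvec (gen_x # gen_g # w) + bvec (gen_g # gen_x # w) \<in> ?I" for w
    using I(5)[of "bvec [gen_x, gen_g] + bvec [gen_g, gen_x]" "bvec w"]
        ideal_gen_superset[of "A_inf_relations :: (gen list \<Rightarrow>\<^sub>0 'k) set" free_algebra] by simp
  have step: "amult free_algebra (bvec [s]) (normal_form t) - normal_form
      (amult (model 1) (model_gen s) t) \<in> ?I"
    for s and t :: "nat \<times> h4 \<Rightarrow>\<^sub>0 'k"
  proof (induction t rule: vec_induct)
    case (basis i)
    obtain n h where i: "i = (n, h)" by force
    show ?case
      unfolding i by (cases s; cases h) (simp_all add: h4_scal_def h4_deg_def I(1) Rg Rx)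
  next
    case (add v w)
    then show ?case using I(2) by (fastforce simp: algebra_simps)
  next
    case (smul c v)
    then show ?case using I(3)[of _ c] by (fastforce simp: fs.scale_right_diff_distrib)
  qed (simp add: I(1))
  have word: "bvec u - normal_form (free_eval (model 1) model_gen (bvec u)) \<in> ?I" for u
  proof (induction u)
    case Nil
    show ?case using I(1) by (simp add: free_eval_simps)
  next
    case (Cons s u)
    let ?t = "free_eval (model 1) model_gen (bvec u) :: nat \<times> h4 \<Rightarrow>\<^sub>0 'k"
    have e: "free_eval (model 1) model_gen (bvec (s # u)) = amult (model 1) (model_gen s) ?t"
      by (simp add: free_eval_simps)
    have split: "bvec (s # u) - normal_form (free_eval (model 1) model_gen (bvec (s # u))) =
      amult free_algebra (bvec [s]) (bvec u - normal_form ?t) +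
      (amult free_algebra (bvec [s]) (normal_form ?t) - normal_form
          (amult (model 1) (model_gen s) ?t))"
      unfolding e by simp
    show ?case unfolding split by (rule I(2)[OF I(4)[OF Cons.IH] step])
  qed
  have reduce: "p - normal_form (free_eval (model 1) model_gen p) \<in> ?I" for p
  proof (induction p rule: vec_induct)
    case (add v w)
    then show ?case using I(2) by (fastforce simp: algebra_simps)
  next
    case (smul c v)
    then show ?case using I(3)[of _ c] by (fastforce simp: fs.scale_right_diff_distrib)
  qed (simp_all add: I(1) word)
  show "{p. free_eval (model (1::'k)) model_gen p = 0} \<subseteq> ?I"
  proof
    fix p assume "p \<in> {p. free_eval (model (1::'k)) model_gen p = 0}"
    then show "p \<in> ?I" using reduce[of p] by simp
  qed
qed

lemma is_A_infinity_model_1: "is_A_infinity (model 1) (bvec (0, H4_g)) (bvec (0, H4_x))"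
proof -
  have "surj (free_eval (model 1) model_gen)"
    by (rule surjI[where f = normal_form]) (rule free_eval_normal_form)
  moreover have "bvec (0, H4_g) \<noteq> (0 :: nat \<times> h4 \<Rightarrow>\<^sub>0 'a)"
    by (metis lookup_single_eq lookup_zero zero_neq_one)
  ultimately show ?thesis
    by (simp add: is_A_infinity_def presented_by_def hopf_algebra_model is_algebra_model
        model_1_kernel
        group_like_def skew_primitive_def)
qed

section \<open>Crossed systems of \<open>k[Y]\<close> and \<open>H\<^sub>4\<close>\<close>

text \<open>
  The only crossed systems are the trivial action \<open>h \<triangleright> p = \<epsilon>(h)p\<close> with the cocycles below, one for
  each scalar \<open>a\<close>, which is determined by \<open>f(x, x) = aY\<close>; since \<open>\<epsilon>(x) = \<epsilon>(gx) = 0\<close>, only even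
  elements act.
\<close>

definition trivial_act :: "(h4 \<times> nat \<Rightarrow>\<^sub>0 'k::field) \<Rightarrow> (nat \<Rightarrow>\<^sub>0 'k)" where
  "trivial_act = lin_ext (\<lambda>(h, n). if h4_odd h then 0 else bvec n)"

definition cocycle :: "'k::field \<Rightarrow> (h4 \<times> h4 \<Rightarrow>\<^sub>0 'k) \<Rightarrow> (nat \<Rightarrow>\<^sub>0 'k)" where
  "cocycle a = lin_ext (\<lambda>(h, h'). if h4_odd h \<and> h4_odd h' then smul (h4_scal a h h') (bvec 1)
     else if h4_odd h \<or> h4_odd h' then 0 else 1)"

lemma trivial_act_bvec [simp]: "trivial_act (bvec (h, n)) = (if h4_odd h then 0 else bvec n)"
  by (simp add: trivial_act_def)

lemma cocycle_bvec [simp]: "cocycle a (bvec (h, h')) =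
  (if h4_odd h \<and> h4_odd h' then smul (h4_scal a h h') (bvec 1) else
      if h4_odd h \<or> h4_odd h' then 0 else 1)"
  by (simp add: cocycle_def)

lemma klinear_trivial_act: "klinear trivial_act"
  and klinear_cocycle: "klinear (cocycle a)"
  by (simp_all add: trivial_act_def cocycle_def klinear_lin_ext)

abbreviation crossed :: "((h4 \<times> nat \<Rightarrow>\<^sub>0 'k::field) \<Rightarrow> (nat \<Rightarrow>\<^sub>0 'k)) \<Rightarrow>
    ((h4 \<times> h4 \<Rightarrow>\<^sub>0 'k) \<Rightarrow> (nat \<Rightarrow>\<^sub>0 'k)) \<Rightarrow> (nat \<times> h4, 'k) hopf_str" where
  "crossed \<equiv> crossed_product polyY sweedlerH4"

lemma klinear_crossed_mult [klinear_intros]: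
  "klinear g \<Longrightarrow> klinear (\<lambda>t. amult (crossed_product A H act f) s (g t))"
  "klinear g \<Longrightarrow> klinear (\<lambda>s. amult (crossed_product A H act f) (g s) t)"
  by (auto simp: crossed_product_def intro!: klinear_intros)

lemmas crossed_mult_linear [simp] = klinearD[OF klinear_crossed_mult(1)[OF klinear_id]]
  klinearD[OF klinear_crossed_mult(2)[OF klinear_id]]

lemma crossed_mult_bvec:
  "amult (crossed act f) (bvec (n, h)) (bvec (n', h')) = sw3 sweedlerH4 (bvec h) (\<lambda>h1 h2 h3.
     sw2 sweedlerH4 (bvec h') (\<lambda>g1 g2. (bvec n * act (h1 \<otimes>\<^sub>k bvec n') * f (h2 \<otimes>\<^sub>k g1)) \<otimes>\<^sub>k amult
         sweedlerH4 h3 g2))"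
  by (simp add: crossed_product_def)

lemma crossed_simps [simp]:
  "aone (crossed act f) = bvec (0, H4_1)" "comult (crossed act f) = dlt"
  "counit (crossed act f) = tensor_counit polyY sweedlerH4"
  by (simp_all add: crossed_product_def)

lemma smul_mult_poly: "smul c p * q = smul c (p * q)" "p * smul c q = smul c (p * q)"
    for p q :: "nat \<Rightarrow>\<^sub>0 'k::field"
proof -
  have s: "smul c r = Poly_Mapping.single 0 c * r" for c and r :: "nat \<Rightarrow>\<^sub>0 'k"
    by (simp add: smul_def mult_map_scale_conv_mult)
  show "smul c p * q = smul c (p * q)" "p * smul c q = smul c (p * q)"
    by (simp_all add: s mult_ac)
qed

lemma crossed_cocycle_eq_model: "crossed trivial_act (cocycle a) = model a"
proof -
  have "amult (crossed trivial_act (cocycle a)) s t = amult (model a) s t" for s t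
  proof (rule bilinear_eqI[where F = "\<lambda>s t. amult (crossed trivial_act (cocycle a)) s t"])
    fix p q :: "nat \<times> h4"
    obtain n h m h' where s: "p = (n, h)" "q = (m, h')" by (metis surj_pair)
    show "amult (crossed trivial_act (cocycle a)) (bvec p) (bvec q) =
        amult (model a) (bvec p) (bvec q)"
      unfolding s crossed_mult_bvec sw3_def
      by (cases h; cases h') (simp_all add: h4_scal_def h4_deg_def mult_single smul_mult_poly)
  qed (intro klinear_intros)+
  then show ?thesis
    by (intro hopf_str.equality) (auto simp: fun_eq_iff)
qed

lemma tensor_hopf_eq_model: "tensor_hopf polyY sweedlerH4 = model 0"
proof -
  have "amult (tensor_hopf polyY sweedlerH4) s t = amult (model 0) s t" for s t :: "nat \<times> h4 \<Rightarrow>\<^sub>0 'a"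
  proof (rule bilinear_eqI[where F = "\<lambda>s t. amult (tensor_hopf polyY sweedlerH4) s t"])
    fix p q :: "nat \<times> h4"
    obtain n h m h' where s: "p = (n, h)" "q = (m, h')" by (metis surj_pair)
    show "amult (tensor_hopf polyY sweedlerH4) (bvec p) (bvec q) =
        amult (model 0 :: (_, 'a) hopf_str) (bvec p) (bvec q)"
      unfolding s by (cases h; cases h') (simp_all add: h4_scal_def h4_deg_def mult_single)
  qed (intro klinear_intros)+
  then show ?thesis
    by (intro hopf_str.equality) (auto simp: fun_eq_iff tensor_hopf_def)
qed

lemmas trivial_act_linear [simp] = klinearD[OF klinear_trivial_act]

lemma trivial_act_tens: "trivial_act (bvec h \<otimes>\<^sub>k p) = (if h4_odd h then 0 else p)"
  by (rule klinear_eqI[where f = "\<lambda>p. trivial_act (bvec h \<otimes>\<^sub>k p)"])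
    (cases "h4_odd h"; auto intro!: klinear_intros klinear_comp[OF klinear_trivial_act])+

lemma weak_action_trivial: "weak_action polyY sweedlerH4 (trivial_act :: _ \<Rightarrow> nat \<Rightarrow>\<^sub>0 'k::field)"
  unfolding weak_action_def
proof (intro conjI allI)
  fix h :: "h4 \<Rightarrow>\<^sub>0 'k" and p q :: "nat \<Rightarrow>\<^sub>0 'k"
  show "klinear (trivial_act :: _ \<Rightarrow> nat \<Rightarrow>\<^sub>0 'k)" by (rule klinear_trivial_act)
  show "trivial_act (aone sweedlerH4 \<otimes>\<^sub>k p) = p" by (simp add: trivial_act_tens)
  show "trivial_act (h \<otimes>\<^sub>k aone polyY) = smul (counit sweedlerH4 h) (aone polyY)"
  proof (rule klinear_eqI[where f = "\<lambda>h. trivial_act (h \<otimes>\<^sub>k aone polyY)"])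
    show "trivial_act (bvec i \<otimes>\<^sub>k aone polyY) = smul (counit sweedlerH4 (bvec i)) (aone polyY)"
        for i
      by (cases i) (simp_all add: lookup_single when_def)
    show "klinear (\<lambda>h. smul (counit sweedlerH4 h) (aone polyY))"
      by (simp add: klinear_iff lookup_add fs.scale_left_distrib fs.scale_right_distrib
          distrib_left)
  qed (auto intro!: klinear_intros klinear_comp[OF klinear_trivial_act])
  show "trivial_act (h \<otimes>\<^sub>k amult polyY p q) =
      sw2 sweedlerH4 h (\<lambda>h1 h2. amult polyY (trivial_act (h1 \<otimes>\<^sub>k p)) (trivial_act (h2 \<otimes>\<^sub>k q)))"
  proof (rule klinear_eqI[where f = "\<lambda>h. trivial_act (h \<otimes>\<^sub>k amult polyY p q)"])
    show "trivial_act (bvec i \<otimes>\<^sub>k amult polyY p q) =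
      sw2 sweedlerH4 (bvec i) (\<lambda>h1 h2. amult polyY (trivial_act (h1 \<otimes>\<^sub>k p))
          (trivial_act (h2 \<otimes>\<^sub>k q)))" for i
      by (cases i) (simp_all add: trivial_act_tens)
  qed (auto intro!: klinear_intros klinear_comp[OF klinear_trivial_act])
qed

lemma crossed_system_cocycle: "crossed_system polyY sweedlerH4 trivial_act (cocycle a)"
  by (simp add: crossed_system_def weak_action_trivial klinear_cocycle crossed_cocycle_eq_model
      hopf_algebra_model)

text \<open>
  The component of an element of \<open>k[Y] \<otimes> H\<^sub>4\<close> at the basis element \<open>h\<close> of \<open>H\<^sub>4\<close>. It extracts a
  value of the cocycle from a product in the crossed product.
\<close>

definition part :: "h4 \<Rightarrow> (nat \<times> h4 \<Rightarrow>\<^sub>0 'k::field) \<Rightarrow> (nat \<Rightarrow>\<^sub>0 'k)" where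
  "part h = lin_ext (\<lambda>(n, h'). if h' = h then bvec n else 0)"

lemma klinear_part: "klinear (part h)"
  by (simp add: part_def klinear_lin_ext)

lemmas part_linear [simp] = klinearD[OF klinear_part]

lemma part_bvec [simp]: "part h (bvec (n, h')) = (if h' = h then bvec n else 0)"
  by (simp add: part_def)

lemma part_tens [simp]: "part h (p \<otimes>\<^sub>k bvec h') = (if h' = h then p else 0)"
  by (rule klinear_eqI[where f = "\<lambda>p. part h (p \<otimes>\<^sub>k bvec h')"])
    (cases "h' = h"; auto intro!: klinear_intros klinear_comp[OF klinear_part])+

text \<open>
  Everything follows from multiplicativity of \<open>\<Delta>\<close> on products of the elements \<open>g = 1 # g\<close>,
  \<open>x = 1 # x\<close> and \<open>Y = Y # 1\<close>. Comparing coordinates of \<open>\<Delta>(x \<cdot> Y)\<close> and \<open>\<Delta>(gx \<cdot> Y)\<close> shows that the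
  action is trivial; the products \<open>g \<cdot> g\<close>, \<open>x \<cdot> g\<close>, \<open>g \<cdot> x\<close> show \<open>f(g,g) = 1\<close> and
  \<open>f(x,g) = f(g,x) = 0\<close>; and \<open>x \<cdot> x = f(x,x) # 1\<close> turns out to be primitive, so
  \<open>f(x,x) = aY\<close>. Associativity then yields the values at \<open>gx = g \<cdot> x\<close>.
\<close>

lemma crossed_system_cases:
  fixes act :: "(h4 \<times> nat \<Rightarrow>\<^sub>0 'k::field_char_0) \<Rightarrow> (nat \<Rightarrow>\<^sub>0 'k)"
  assumes "crossed_system polyY sweedlerH4 act f"
  obtains a where "act = trivial_act" "f = cocycle a"
proof -
  let ?m = "amult (crossed act f)"
  have wa: "klinear act" "\<And>h. act (h \<otimes>\<^sub>k 1) = smul (counit sweedlerH4 h) 1"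
      "\<And>p. act (bvec H4_1 \<otimes>\<^sub>k p) = p"
    "\<And>h p q. act (h \<otimes>\<^sub>k (p * q)) = sw2 sweedlerH4 h (\<lambda>h1 h2. act (h1 \<otimes>\<^sub>k p) * act (h2 \<otimes>\<^sub>k q))"
    and lin_f: "klinear f" and bi: "is_bialgebra (crossed act f)"
    using assms by (simp_all add: crossed_system_def weak_action_def hopf_algebra_def)
  note alg = is_bialgebraD(1)[OF bi]
  have unit: "?m (bvec (0, H4_1)) t = t" "?m t (bvec (0, H4_1)) = t" for t
    using is_algebraD(4,5)[OF alg] by simp_all
  have assoc: "?m (?m s t) u = ?m s (?m t u)" for s t u
    by (rule is_algebraD(3)[OF alg])
  have mult: "dlt (?m s t) = amult (tensor_hopf (crossed act f) (crossed act f)) (dlt s) (dlt t)"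
      for s t
    using is_bialgebraD(4)[OF bi] by simp
  have act_1: "act (bvec (h, 0)) = (if h4_odd h then 0 else 1)" for h
    using wa(2)[of "bvec h"] by (cases h) (simp_all add: lookup_single when_def)
  have act1: "act (bvec (H4_1, n)) = bvec n" for n
    using wa(3)[of "bvec n"] by simp
  note expand = crossed_mult_bvec sw3_def
  \<comment> \<open>The unit law of the crossed product normalises the cocycle.\<close>
  have f1h: "f (bvec (H4_1, h)) = (if h4_odd h then 0 else 1)" for h
  proof -
    have *: "f (bvec (H4_1, H4_1)) = 1"
      using arg_cong[OF unit(1)[of "bvec (0, H4_1)"], of "part H4_1"] by (simp add: expand act1)
    have **: "f (bvec (H4_1, H4_g)) = 1"
      using arg_cong[OF unit(1)[of "bvec (0, H4_g)"], of "part H4_g"] by (simp add: expand act1)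
    show ?thesis
      using arg_cong[OF unit(1)[of "bvec (0, H4_x)"], of "part H4_1"]
        arg_cong[OF unit(1)[of "bvec (0, H4_gx)"], of "part H4_g"]
      by (cases h) (simp_all add: expand act1 * **)
  qed
  have fh1: "f (bvec (h, H4_1)) = (if h4_odd h then 0 else 1)" for h
  proof -
    have *: "f (bvec (H4_1, H4_1)) = 1" by (simp add: f1h)
    have **: "f (bvec (H4_g, H4_1)) = 1"
      using arg_cong[OF unit(2)[of "bvec (0, H4_g)"], of "part H4_g"] by (simp add: expand act_1)
    show ?thesis
      using arg_cong[OF unit(2)[of "bvec (0, H4_x)"], of "part H4_1"]
        arg_cong[OF unit(2)[of "bvec (0, H4_gx)"], of "part H4_g"]
      by (cases h) (simp_all add: expand act_1 * **)
  qed
  note expand = expand f1h fh1 act1 act_1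
  note coeff = lookup_dlt lookup_add lookup_minus lookup_single when_def
  \<comment> \<open>The values of the action on \<open>Y\<close> at \<open>g\<close>, \<open>x\<close> and \<open>gx\<close>.\<close>
  define p where "p = act (bvec (H4_g, Suc 0))"
  define q where "q = act (bvec (H4_x, Suc 0))"
  define s where "s = act (bvec (H4_gx, Suc 0))"
  have XY: "?m (bvec (0, H4_x)) (bvec (Suc 0, H4_1)) = q \<otimes>\<^sub>k bvec H4_1 + p \<otimes>\<^sub>k bvec H4_x"
    by (simp add: expand p_def q_def)
  have GY: "?m (bvec (0, H4_g)) (bvec (Suc 0, H4_1)) = p \<otimes>\<^sub>k bvec H4_g"
    by (simp add: expand p_def)
  have GXY: "?m (bvec (0, H4_gx)) (bvec (Suc 0, H4_1)) = s \<otimes>\<^sub>k bvec H4_g + bvec (Suc 0, H4_gx)"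
    by (simp add: expand s_def)
  have \<Delta>XY: "dlt (q \<otimes>\<^sub>k bvec H4_1 + p \<otimes>\<^sub>k bvec H4_x) =
      (q \<otimes>\<^sub>k bvec H4_1 + p \<otimes>\<^sub>k bvec H4_x) \<otimes>\<^sub>k bvec (0, H4_1) + bvec ((0, H4_x), (Suc 0, H4_1)) +
      (p \<otimes>\<^sub>k bvec H4_g) \<otimes>\<^sub>k bvec (0, H4_x) + bvec (0, H4_g) \<otimes>\<^sub>k (q \<otimes>\<^sub>k bvec H4_1 + p \<otimes>\<^sub>k bvec H4_x)"
    unfolding XY[symmetric] mult by (simp add: XY GY unit add_ac)
  have \<Delta>GXY: "dlt (s \<otimes>\<^sub>k bvec H4_g + bvec (Suc 0, H4_gx)) =
      (s \<otimes>\<^sub>k bvec H4_g + bvec (Suc 0, H4_gx)) \<otimes>\<^sub>k bvec (0, H4_g) +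
          bvec (0, H4_gx) \<otimes>\<^sub>k (p \<otimes>\<^sub>k bvec H4_g) +
      bvec ((Suc 0, H4_1), (0, H4_gx)) + bvec (0, H4_1) \<otimes>\<^sub>k (s \<otimes>\<^sub>k bvec H4_g + bvec (Suc 0, H4_gx))"
    unfolding GXY[symmetric] mult by (simp add: GXY GY unit add_ac)
  have p: "p = bvec (Suc 0)"
  proof (rule poly_mapping_eqI)
    fix j
    have "coord p 0 = 0"
      using arg_cong[OF \<Delta>XY, of "\<lambda>t. coord t ((0, H4_g), (0, H4_x))"] by (simp add: coeff)
    then show "coord p j = coord (bvec (Suc 0)) j"
      using arg_cong[OF \<Delta>XY, of "\<lambda>t. coord t ((0, H4_x), (j, H4_1))"] by (cases j)
          (auto simp: coeff)
  qed
  have q: "q = 0"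
    by (rule poly_mapping_eqI)
      (use arg_cong[OF \<Delta>XY, of "\<lambda>t. coord t ((0, H4_g), (_, H4_1))"] in \<open>simp add: coeff\<close>)
  have s: "s = 0"
    by (rule poly_mapping_eqI)
      (use arg_cong[OF \<Delta>GXY, of "\<lambda>t. coord t ((0, H4_1), (_, H4_g))"] in \<open>simp add: coeff\<close>)
  have actY: "act (bvec (h, Suc 0)) = (if h4_odd h then 0 else bvec (Suc 0))" for h
    using p q s by (cases h) (simp_all add: act1 p_def q_def s_def)
  \<comment> \<open>From \<open>Y\<close> to all powers of \<open>Y\<close> by the product rule of a weak action.\<close>
  have act: "act (bvec (h, n)) = (if h4_odd h then 0 else bvec n)" for h n
  proof (induction n arbitrary: h)
    case (Suc n)
    have "act (bvec (h, Suc n)) = act (bvec h \<otimes>\<^sub>k (bvec (Suc 0) * bvec n))" by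
        (simp add: mult_single)
    also have "\<dots> = (if h4_odd h then 0 else bvec (Suc n))"
      unfolding wa(4) by (cases h) (simp_all add: actY Suc.IH mult_single)
    finally show ?case .
  qed (simp add: act_1)
  have act_eq: "act = trivial_act"
  proof
    fix v
    show "act v = trivial_act v"
      by (rule tensor_eqI[OF wa(1) klinear_trivial_act]) (simp add: act)
  qed
  note expand = crossed_mult_bvec sw3_def f1h fh1 act mult_single
  \<comment> \<open>The square of the group-like \<open>g\<close> is group-like.\<close>
  have GG: "?m (bvec (0, H4_g)) (bvec (0, H4_g)) = f (bvec (H4_g, H4_g)) \<otimes>\<^sub>k bvec H4_1"
    by (simp add: expand)
  have fgg: "f (bvec (H4_g, H4_g)) = 1"
  proof -
    let ?u = "f (bvec (H4_g, H4_g))"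
    have \<Delta>: "dlt (?u \<otimes>\<^sub>k bvec H4_1) = (?u \<otimes>\<^sub>k bvec H4_1) \<otimes>\<^sub>k (?u \<otimes>\<^sub>k bvec H4_1)"
      unfolding GG[symmetric] mult by simp
    have mul: "of_nat ((i + j) choose i) * coord ?u (i + j) = coord ?u i * coord ?u j" for i j
      using arg_cong[OF \<Delta>, of "\<lambda>t. coord t ((i, H4_1), (j, H4_1))"] by (simp add: coeff)
    have fin: "finite {n. coord ?u n \<noteq> 0}" by simp
    have "coord ?u 0 = 1"
      using is_bialgebraD(6)[OF bi, of "bvec (0, H4_g)" "bvec (0, H4_g)"] by (simp add: GG coeff)
    then show ?thesis
      using group_like_coefficients(1)[OF fin mul]
      by (intro poly_mapping_eqI) (auto simp: lookup_one when_def)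
  qed
  define u where "u = f (bvec (H4_x, H4_g))"
  have XG: "?m (bvec (0, H4_x)) (bvec (0, H4_g)) = u \<otimes>\<^sub>k bvec H4_g - bvec (0, H4_gx)"
    by (simp add: expand fgg u_def)
  define v where "v = f (bvec (H4_g, H4_x))"
  have GX: "?m (bvec (0, H4_g)) (bvec (0, H4_x)) = v \<otimes>\<^sub>k bvec H4_g + bvec (0, H4_gx)"
    by (simp add: expand fgg v_def)
  note GG = GG[unfolded fgg, simplified]
  have \<Delta>XG: "dlt (u \<otimes>\<^sub>k bvec H4_g - bvec (0, H4_gx)) =
      (u \<otimes>\<^sub>k bvec H4_g - bvec (0, H4_gx)) \<otimes>\<^sub>k bvec (0, H4_g) +
      bvec (0, H4_1) \<otimes>\<^sub>k (u \<otimes>\<^sub>k bvec H4_g - bvec (0, H4_gx))"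
    unfolding XG[symmetric] mult by (simp add: XG GG unit)
  have u: "u = 0"
    by (rule poly_mapping_eqI)
      (use arg_cong[OF \<Delta>XG, of "\<lambda>t. coord t ((0, H4_1), (_, H4_g))"] in \<open>simp add: coeff\<close>)
  have \<Delta>GX: "dlt (v \<otimes>\<^sub>k bvec H4_g + bvec (0, H4_gx)) =
      (v \<otimes>\<^sub>k bvec H4_g + bvec (0, H4_gx)) \<otimes>\<^sub>k bvec (0, H4_g) +
      bvec (0, H4_1) \<otimes>\<^sub>k (v \<otimes>\<^sub>k bvec H4_g + bvec (0, H4_gx))"
    unfolding GX[symmetric] mult by (simp add: GX GG unit)
  have v: "v = 0"
    by (rule poly_mapping_eqI)
      (use arg_cong[OF \<Delta>GX, of "\<lambda>t. coord t ((0, H4_1), (_, H4_g))"] in \<open>simp add: coeff\<close>)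
  note XG = XG[unfolded u, simplified] and GX = GX[unfolded v, simplified]
  note expand = expand fgg u[unfolded u_def] v[unfolded v_def]
  \<comment> \<open>In \<open>\<Delta>(x)\<^sup>2\<close>, the cross terms \<open>xg \<otimes> x\<close> and \<open>gx \<otimes> x\<close> cancel.\<close>
  have XX: "?m (bvec (0, H4_x)) (bvec (0, H4_x)) = f (bvec (H4_x, H4_x)) \<otimes>\<^sub>k bvec H4_1"
    by (simp add: expand)
  obtain a where fxx: "f (bvec (H4_x, H4_x)) = smul a (bvec (Suc 0))"
  proof
    let ?w = "f (bvec (H4_x, H4_x))"
    have \<Delta>: "dlt (?w \<otimes>\<^sub>k bvec H4_1) = (?w \<otimes>\<^sub>k bvec H4_1) \<otimes>\<^sub>k bvec (0, H4_1) +
        bvec (0, H4_1) \<otimes>\<^sub>k (?w \<otimes>\<^sub>k bvec H4_1)"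
      unfolding XX[symmetric] mult by (simp add: XX XG GX GG unit)
    have "of_nat ((i + j) choose i) * coord ?w (i + j) =
        (if j = 0 then coord ?w i else 0) + (if i = 0 then coord ?w j else 0)" for i j
      using arg_cong[OF \<Delta>, of "\<lambda>t. coord t ((i, H4_1), (j, H4_1))"] by (auto simp: coeff)
    from primitive_coefficients[OF this]
    show "?w = smul (coord ?w 1) (bvec (Suc 0))"
      by (intro poly_mapping_eqI) (auto simp: lookup_single when_def)
  qed
  note XX = XX[unfolded fxx, simplified]
  \<comment> \<open>The remaining products follow from \<open>gx = g \<cdot> x\<close> by associativity.\<close>
  have GGX: "?m (bvec (0, H4_g)) (bvec (0, H4_gx)) = bvec (0, H4_x)"
    using assoc[of "bvec (0, H4_g)" "bvec (0, H4_g)" "bvec (0, H4_x)"] by (simp add: GG GX unit)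
  have GXG: "?m (bvec (0, H4_gx)) (bvec (0, H4_g)) = - bvec (0, H4_x)"
    using assoc[of "bvec (0, H4_g)" "bvec (0, H4_x)" "bvec (0, H4_g)"] by (simp add: GX XG GGX)
  have GY': "?m (bvec (0, H4_g)) (bvec (Suc 0, H4_1)) = bvec (Suc 0, H4_g)"
    by (simp add: GY p)
  have GXX: "?m (bvec (0, H4_gx)) (bvec (0, H4_x)) = smul a (bvec (Suc 0, H4_g))"
    using assoc[of "bvec (0, H4_g)" "bvec (0, H4_x)" "bvec (0, H4_x)"] by (simp add: GX XX GY')
  have XGX: "?m (bvec (0, H4_x)) (bvec (0, H4_gx)) = - smul a (bvec (Suc 0, H4_g))"
    using assoc[of "bvec (0, H4_x)" "bvec (0, H4_g)" "bvec (0, H4_x)"] by (simp add: GX XG GXX)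
  have GXGX: "?m (bvec (0, H4_gx)) (bvec (0, H4_gx)) = - smul a (bvec (Suc 0, H4_1))"
    using assoc[of "bvec (0, H4_gx)" "bvec (0, H4_g)" "bvec (0, H4_x)"] by (simp add: GX GXG XX)
  \<comment> \<open>Components of these products give the remaining values of the cocycle.\<close>
  have fggx: "f (bvec (H4_g, H4_gx)) = 0"
    using arg_cong[OF GGX, of "part H4_1"] by (simp add: expand)
  have fgxg: "f (bvec (H4_gx, H4_g)) = 0"
    using arg_cong[OF GXG, of "part H4_1"] by (simp add: expand)
  have fxgx: "f (bvec (H4_x, H4_gx)) = - smul a (bvec (Suc 0))"
    using arg_cong[OF XGX, of "part H4_g"] by (simp add: expand fggx fgxg)
  have fgxx: "f (bvec (H4_gx, H4_x)) = smul a (bvec (Suc 0))"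
    using arg_cong[OF GXX, of "part H4_g"] by (simp add: expand fggx fgxg)
  have fgxgx: "f (bvec (H4_gx, H4_gx)) = - smul a (bvec (Suc 0))"
    using arg_cong[OF GXGX, of "part H4_1"] by (simp add: expand fggx fgxg)
  have "f (bvec (h, h')) = cocycle a (bvec (h, h'))" for h h'
    by (cases h; cases h')
      (simp_all add: h4_scal_def f1h fh1 fgg fxx fggx fgxg fxgx fgxx fgxgx u[unfolded u_def]
          v[unfolded v_def])
  then have "f t = cocycle a t" for t
    by (rule tensor_eqI[OF lin_f klinear_cocycle])
  then have "f = cocycle a" by (rule ext)
  with act_eq show ?thesis by (rule that)
qed

lemma CS_eq: "CS polyY sweedlerH4 = {(trivial_act, cocycle a) | a :: 'k::field_char_0. True}"
  by (auto simp: CS_def crossed_system_cocycle elim: crossed_system_cases)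

lemma cocycle_inj: "cocycle a = cocycle a' \<longleftrightarrow> a = a'"
proof
  assume "cocycle a = cocycle a'"
  then have "coord (cocycle a (bvec (H4_x, H4_x))) 1 = coord (cocycle a' (bvec (H4_x, H4_x))) 1" by
      simp
  then show "a = a'" by (simp add: h4_scal_def)
qed simp

section \<open>The cohomology set\<close>

definition poly_anti :: "(nat \<Rightarrow>\<^sub>0 'k::field) \<Rightarrow> (nat \<Rightarrow>\<^sub>0 'k)" where
  "poly_anti = lin_ext (\<lambda>n. smul ((-1) ^ n) (bvec n))"

lemma klinear_poly_anti: "klinear poly_anti"
  by (simp add: poly_anti_def klinear_lin_ext)

lemma is_antipode_poly_anti: "is_antipode polyY (poly_anti :: (nat \<Rightarrow>\<^sub>0 'k::field) \<Rightarrow> _)"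
  unfolding is_antipode_def
proof (intro conjI allI)
  show "klinear (poly_anti :: (nat \<Rightarrow>\<^sub>0 'k) \<Rightarrow> _)" by (rule klinear_poly_anti)
  have lin: "klinear (\<lambda>t. sw2 polyY t F)"
    "klinear (\<lambda>t. smul (counit polyY t) (aone polyY))" for F :: "_ \<Rightarrow> _ \<Rightarrow> (nat \<Rightarrow>\<^sub>0 'k)"
    by (auto intro!: klinear_intros simp: klinear_iff[of "\<lambda>t. smul (_ t) _"] lookup_add
        fs.scale_left_distrib)
  fix t :: "nat \<Rightarrow>\<^sub>0 'k"
  show "sw2 polyY t (\<lambda>h1 h2. amult polyY (poly_anti h1) h2) = smul (counit polyY t) (aone polyY)"
    by (rule klinear_eqI[OF lin])
      (simp add: sw2_polyY_bvec poly_anti_def smul_mult_poly mult_single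
        alternating_binomial_smul lookup_single when_def)
  show "sw2 polyY t (\<lambda>h1 h2. amult polyY h1 (poly_anti h2)) = smul (counit polyY t) (aone polyY)"
    by (rule klinear_eqI[OF lin])
      (simp add: sw2_polyY_bvec poly_anti_def smul_mult_poly mult_single
        alternating_binomial_smul lookup_single when_def)
qed

text \<open>
  \<^const>\<open>antipode\<close> is a definite description, so its value requires uniqueness: the antipode axiom at
  \<open>Y\<^sup>n\<close> determines \<open>S(Y\<^sup>n)\<close> from the values at lower powers.
\<close>

lemma antipode_polyY: "antipode polyY = (poly_anti :: (nat \<Rightarrow>\<^sub>0 'k::field) \<Rightarrow> _)"
  unfolding antipode_def
proof (rule the_equality)
  fix S :: "(nat \<Rightarrow>\<^sub>0 'k) \<Rightarrow> (nat \<Rightarrow>\<^sub>0 'k)"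
  assume S: "is_antipode polyY S"
  have rec: "(\<Sum>k<n. smul (of_nat (n choose k)) (T (bvec k) * bvec (n - k))) + T (bvec n) =
      smul (counit polyY (bvec n)) 1" if "is_antipode polyY T" for T :: "(nat \<Rightarrow>\<^sub>0 'k) \<Rightarrow>
          (nat \<Rightarrow>\<^sub>0 'k)" and n
  proof -
    have "(\<Sum>k\<le>n. smul (of_nat (n choose k)) (T (bvec k) * bvec (n - k))) =
        smul (counit polyY (bvec n)) 1"
      using that by (simp add: is_antipode_def sw2_polyY_bvec
          flip: sw2_polyY_bvec[of n "\<lambda>h1 h2. T h1 * h2"])
    then show ?thesis by (simp add: lessThan_Suc_atMost[symmetric])
  qed
  have "S (bvec n) = poly_anti (bvec n)" for n
  proof (induction n rule: less_induct)
    case (less n)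
    then have below: "(\<Sum>k<n. smul (of_nat (n choose k)) (S (bvec k) * bvec (n - k))) =
        (\<Sum>k<n. smul (of_nat (n choose k)) (poly_anti (bvec k) * bvec (n - k)))"
      by simp
    show ?case
      using rec[OF S, of n, folded rec[OF is_antipode_poly_anti, of n]] unfolding below
      by (simp only: add_left_cancel)
  qed
  moreover have "klinear S" using S by (simp add: is_antipode_def)
  ultimately have "S p = poly_anti p" for p
    by (rule klinear_eqI[where f = S, rotated 2]) (rule klinear_poly_anti)
  then show "S = poly_anti" by (rule ext)
qed (rule is_antipode_poly_anti)

lemma poly_anti_simps [simp]: "poly_anti 1 = 1" "poly_anti 0 = 0"
  by (simp_all add: poly_anti_def)

text \<open>
  Cocentrality at \<open>x\<close> reads \<open>r(x) \<otimes> 1 + r(g) \<otimes> x = r(1) \<otimes> x + r(x) \<otimes> g\<close>, so \<open>r(g) = r(1) = 1\<close> and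
  \<open>r(x) = 0\<close>; likewise for \<open>gx\<close>. There is thus only one unitary cocentral map, \<open>h \<mapsto> \<epsilon>(h)1\<close>.
\<close>

lemma unitary_cocentral_trivial:
  assumes r: "unitary_cocentral polyY sweedlerH4 r"
  shows "r (bvec h) = (if h4_odd h then 0 else 1)"
proof -
  have one: "r (bvec H4_1) = 1" using r by (simp add: unitary_cocentral_def)
  have co: "sw2 sweedlerH4 h (\<lambda>h1 h2. r h1 \<otimes>\<^sub>k h2) = sw2 sweedlerH4 h (\<lambda>h1 h2. r h2 \<otimes>\<^sub>k h1)" for h
    using r by (simp add: unitary_cocentral_def)
  have g: "r (bvec H4_g) = 1"
    using arg_cong[OF co[of "bvec H4_x"], of "part H4_x"] by (simp add: one)
  show ?thesis
    using arg_cong[OF co[of "bvec H4_x"], of "part H4_1"]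
        arg_cong[OF co[of "bvec H4_gx"], of "part H4_g"]
    by (cases h) (simp_all add: one g)
qed

lemma comult_polyY_one: "comult polyY (1 :: nat \<Rightarrow>\<^sub>0 'k::field) = bvec (0, 0)"
  by (simp add: polyY_def flip: zero_prod_def)

definition counit_map :: "(h4 \<Rightarrow>\<^sub>0 'k::field) \<Rightarrow> (nat \<Rightarrow>\<^sub>0 'k)" where
  "counit_map = lin_ext (\<lambda>h. if h4_odd h then 0 else 1)"

lemma klinear_counit_map: "klinear counit_map"
  by (simp add: counit_map_def klinear_lin_ext)

lemma counit_map_bvec [simp]: "counit_map (bvec h) = (if h4_odd h then 0 else 1)"
  by (simp add: counit_map_def)

lemmas counit_map_linear [simp] = klinearD[OF klinear_counit_map]

lemma unitary_cocentral_counit_map: "unitary_cocentral polyY sweedlerH4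
    (counit_map :: _ \<Rightarrow> (nat \<Rightarrow>\<^sub>0 'k::field))"
  unfolding unitary_cocentral_def coalgebra_map_def
proof (intro conjI allI)
  note comp = klinear_comp[OF klinear_counit_map] klinear_comp[OF klinear_comult_polyY]
  note klinear_comult_polyY' = klinearD(3)[OF klinear_comult_polyY]
  fix h :: "h4 \<Rightarrow>\<^sub>0 'k"
  show "comult polyY (counit_map h) = sw2 sweedlerH4 h (\<lambda>h1 h2. counit_map h1 \<otimes>\<^sub>k counit_map h2)"
  proof (rule klinear_eqI[where f = "\<lambda>h. comult polyY (counit_map h)"])
    show "comult polyY (counit_map (bvec i)) =
        sw2 sweedlerH4 (bvec i) (\<lambda>h1 h2. counit_map h1 \<otimes>\<^sub>k counit_map h2)" for i
      by (cases i) (simp_all add: comult_polyY_one klinear_comult_polyY')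
  qed (auto intro!: klinear_intros comp klinear_counit_map)
  show "sw2 sweedlerH4 h (\<lambda>h1 h2. counit_map h1 \<otimes>\<^sub>k h2) =
      sw2 sweedlerH4 h (\<lambda>h1 h2. counit_map h2 \<otimes>\<^sub>k h1)"
  proof (rule klinear_eqI[where f = "\<lambda>h. sw2 sweedlerH4 h (\<lambda>h1 h2. counit_map h1 \<otimes>\<^sub>k h2)"])
    show "sw2 sweedlerH4 (bvec i) (\<lambda>h1 h2. counit_map h1 \<otimes>\<^sub>k h2) =
        sw2 sweedlerH4 (bvec i) (\<lambda>h1 h2. counit_map h2 \<otimes>\<^sub>k h1)" for i
      by (cases i) simp_all
  qed (auto intro!: klinear_intros comp)
  show "counit polyY (counit_map h) = counit sweedlerH4 h"
  proof (induction h rule: vec_induct)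
    case (basis i)
    show ?case by (cases i) (simp_all add: lookup_single when_def)
  qed (simp_all add: lookup_add algebra_simps)
qed (simp_all add: klinear_counit_map)

text \<open>
  With the trivial cocentral map, the transformation formulas for the action and the cocycle become
  identities, so that equivalent crossed systems are equal.
\<close>

lemma CS_rel_eq: "CS_rel polyY sweedlerH4 = Id_on
    (CS polyY (sweedlerH4 :: (h4, 'k::field_char_0) hopf_str))"
proof (intro equalityI subsetI)
  fix z :: "(((h4 \<times> nat \<Rightarrow>\<^sub>0 'k) \<Rightarrow> (nat \<Rightarrow>\<^sub>0 'k)) \<times> ((h4 \<times> h4 \<Rightarrow>\<^sub>0 'k) \<Rightarrow> (nat \<Rightarrow>\<^sub>0 'k))) \<times>
    (((h4 \<times> nat \<Rightarrow>\<^sub>0 'k) \<Rightarrow> (nat \<Rightarrow>\<^sub>0 'k)) \<times> ((h4 \<times> h4 \<Rightarrow>\<^sub>0 'k) \<Rightarrow> (nat \<Rightarrow>\<^sub>0 'k)))"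
  assume "z \<in> CS_rel polyY sweedlerH4"
  then obtain act f act' f' r where z: "z = ((act, f), (act', f'))"
    and CS: "(act, f) \<in> CS polyY sweedlerH4" "(act', f') \<in> CS polyY sweedlerH4"
    and r: "unitary_cocentral polyY sweedlerH4 r"
    and f': "\<And>h g. f' (h \<otimes>\<^sub>k g) = sw4 sweedlerH4 h (\<lambda>h1 h2 h3 h4. sw3 sweedlerH4 g (\<lambda>g1 g2 g3.
           amult polyY (amult polyY (amult polyY (r h1) (act (h2 \<otimes>\<^sub>k r g1))) (f (h3 \<otimes>\<^sub>k g2)))
             (antipode polyY (r (amult sweedlerH4 h4 g3)))))"
    by (auto simp: CS_rel_def)
  obtain a a' where a: "act = trivial_act" "f = cocycle a" "act' = trivial_act" "f' = cocycle a'"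
    using CS by (auto simp: CS_eq)
  have "klinear r" using r by (simp add: unitary_cocentral_def coalgebra_map_def)
  note r_simps = unitary_cocentral_trivial[OF r] klinearD[OF this]
  have "f' (bvec H4_x \<otimes>\<^sub>k bvec H4_x) = f (bvec H4_x \<otimes>\<^sub>k bvec H4_x)"
    unfolding f' a(1,2) by (simp add: sw4_def sw3_def r_simps antipode_polyY)
  from arg_cong[OF this, of "\<lambda>p. coord p 1"] have "a' = a"
    by (simp add: a h4_scal_def)
  then show "z \<in> Id_on (CS polyY sweedlerH4)" using CS by (auto simp: z a)
next
  fix z :: "(((h4 \<times> nat \<Rightarrow>\<^sub>0 'k) \<Rightarrow> (nat \<Rightarrow>\<^sub>0 'k)) \<times> ((h4 \<times> h4 \<Rightarrow>\<^sub>0 'k) \<Rightarrow> (nat \<Rightarrow>\<^sub>0 'k))) \<times>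
    (((h4 \<times> nat \<Rightarrow>\<^sub>0 'k) \<Rightarrow> (nat \<Rightarrow>\<^sub>0 'k)) \<times> ((h4 \<times> h4 \<Rightarrow>\<^sub>0 'k) \<Rightarrow> (nat \<Rightarrow>\<^sub>0 'k)))"
  assume "z \<in> Id_on (CS polyY sweedlerH4)"
  then obtain a where z: "z = ((trivial_act, cocycle a), (trivial_act, cocycle a))" by
      (auto simp: CS_eq)
  have act: "trivial_act (h \<otimes>\<^sub>k p) = sw3 sweedlerH4 h (\<lambda>h1 h2 h3.
      amult polyY (amult polyY (counit_map h1) (trivial_act (h2 \<otimes>\<^sub>k p)))
          (antipode polyY (counit_map h3)))"
    for h and p :: "nat \<Rightarrow>\<^sub>0 'k"
    unfolding sw3_def
  proof (rule klinear_eqI[where v = h and f = "\<lambda>h. trivial_act (h \<otimes>\<^sub>k p)"])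
    show "trivial_act (bvec i \<otimes>\<^sub>k p) = sw2 sweedlerH4 (bvec i) (\<lambda>h1 h'. sw2 sweedlerH4 h' (\<lambda>h2 h3.
      amult polyY (amult polyY (counit_map h1) (trivial_act (h2 \<otimes>\<^sub>k p)))
          (antipode polyY (counit_map h3))))" for i
      by (cases i) (simp_all add: trivial_act_tens antipode_polyY)
  qed (auto intro!: klinear_intros klinear_comp[OF klinear_trivial_act])
  define R :: "(h4 \<Rightarrow>\<^sub>0 'k) \<Rightarrow> (h4 \<Rightarrow>\<^sub>0 'k) \<Rightarrow> (nat \<Rightarrow>\<^sub>0 'k)" where
    "R h g = sw4 sweedlerH4 h (\<lambda>h1 h2 h3 h4. sw3 sweedlerH4 g (\<lambda>g1 g2 g3.
      amult polyY (amult polyY (amult polyY (counit_map h1) (trivial_act (h2 \<otimes>\<^sub>k counit_map g1)))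
          (cocycle a (h3 \<otimes>\<^sub>k g2)))
        (antipode polyY (counit_map (amult sweedlerH4 h4 g3)))))" for h g
  have coc: "cocycle a (h \<otimes>\<^sub>k g) = R h g" for h g
  proof (rule bilinear_eqI[where F = "\<lambda>h g. cocycle a (h \<otimes>\<^sub>k g)" and G = R])
    show "cocycle a (bvec i \<otimes>\<^sub>k bvec j) = R (bvec i) (bvec j)" for i j
      unfolding R_def sw4_def sw3_def antipode_polyY by (cases i; cases j) simp_all
  qed (unfold R_def sw4_def sw3_def, (intro klinear_intros klinear_comp[OF klinear_cocycle])+)
  show "z \<in> CS_rel polyY sweedlerH4"
    unfolding z CS_rel_def mem_Collect_eq case_prod_conv
  proof (intro conjI exI[of _ counit_map] allI)
    show "(trivial_act, cocycle a) \<in> CS polyY sweedlerH4" by (auto simp: CS_eq)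
    then show "(trivial_act, cocycle a) \<in> CS polyY sweedlerH4" .
  qed (rule unitary_cocentral_counit_map act coc[unfolded R_def])+
qed

lemma H2_bij: "\<exists>\<Phi>. bij_betw \<Phi> (H2 sweedlerH4 (polyY :: (nat, 'k::field_char_0) hopf_str))
    (UNIV :: 'k set)"
proof -
  have "H2 sweedlerH4 polyY = range (\<lambda>a :: 'k. {(trivial_act, cocycle a)})"
    unfolding H2_def CS_rel_eq by (auto simp: quotient_def CS_eq Id_on_def Image_def)
  then have "bij_betw (\<lambda>a :: 'k. {(trivial_act, cocycle a)}) UNIV (H2 sweedlerH4 polyY)"
    by (auto simp: bij_betw_def cocycle_inj intro!: injI)
  then show ?thesis using bij_betw_inv by blast
qed

text \<open>
  A finite set of vectors involves finitely many of the infinitely many basis vectors.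
\<close>

lemma infinite_dimensional:
  fixes L :: "('b, 'k::field) hopf_str"
  assumes "L \<cong>\<^sub>H model a"
  shows "\<not> (\<exists>B. finite B \<and> fs.span B = (UNIV :: ('b \<Rightarrow>\<^sub>0 'k) set))"
proof
  assume "\<exists>B. finite B \<and> fs.span B = (UNIV :: ('b \<Rightarrow>\<^sub>0 'k) set)"
  then obtain B :: "('b \<Rightarrow>\<^sub>0 'k) set" where B: "finite B" "fs.span B = UNIV" by blast
  obtain \<phi> where \<phi>: "hopf_iso L (model a) \<phi>" using assms by (auto simp: hopf_isomorphic_def)
  note lin = klinearD[OF hopf_isoD(2)[OF \<phi>]]
  define K where "K = (\<Union>b\<in>B. Poly_Mapping.keys (\<phi> b))"
  have "fs.subspace {y. \<forall>s. s \<notin> K \<longrightarrow> coord (\<phi> y) s = 0}"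
    by (auto simp: fs.subspace_def lin lookup_add)
  then have "fs.span B \<subseteq> {y. \<forall>s. s \<notin> K \<longrightarrow> coord (\<phi> y) s = 0}"
    by (intro fs.span_minimal) (auto simp: K_def in_keys_iff)
  then have 0: "coord (\<phi> y) s = 0" if "s \<notin> K" for y s
    using that \<open>fs.span B \<subseteq> _\<close> unfolding B(2) by blast
  have "s \<in> K" for s
  proof (rule ccontr)
    assume "s \<notin> K"
    obtain y where "\<phi> y = bvec s" using hopf_isoD(1)[OF \<phi>] by (metis bij_pointE)
    with 0[OF \<open>s \<notin> K\<close>, of y] show False by simp
  qed
  then have "(UNIV :: (nat \<times> h4) set) = K" by blast
  moreover have "finite K" using B(1) by (simp add: K_def)
  moreover have "infinite (UNIV :: (nat \<times> h4) set)" by (simp add: finite_prod)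
  ultimately show False by simp
qed

theorem proposition4p2:
  shows
    "(\<exists>(L :: (nat \<times> h4, 'k::field_char_0) hopf_str) g x. is_A_infinity L g x) \<and>
     (\<forall>(A_inf :: ('b, 'k) hopf_str) g x. is_A_infinity A_inf g x \<longrightarrow>
        \<not> (\<exists>B. finite B \<and> fs.span B = (UNIV :: ('b \<Rightarrow>\<^sub>0 'k) set)) \<and>
        (\<forall>(act, f) \<in> CS polyY sweedlerH4.
           crossed_product polyY sweedlerH4 act f \<cong>\<^sub>H tensor_hopf polyY sweedlerH4 \<or>
           crossed_product polyY sweedlerH4 act f \<cong>\<^sub>H A_inf) \<and>
        (\<exists>(act, f) \<in> CS polyY sweedlerH4. crossed_product polyY sweedlerH4 act f \<cong>\<^sub>H A_inf) \<and>
        \<not> tensor_hopf polyY sweedlerH4 \<cong>\<^sub>H A_inf \<and>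
        Aut_Hopf A_inf \<cong> (field_units :: 'k monoid)) \<and>
     (\<exists>(act, f) \<in> CS (polyY :: (nat, 'k) hopf_str) sweedlerH4.
        crossed_product polyY sweedlerH4 act f \<cong>\<^sub>H tensor_hopf polyY sweedlerH4) \<and>
     Aut_Hopf (tensor_hopf polyY sweedlerH4 :: (nat \<times> h4, 'k) hopf_str) \<cong>
       (field_units :: 'k monoid) \<times>\<times> (field_units :: 'k monoid) \<and>
     (\<exists>\<Phi>. bij_betw \<Phi> (H2 sweedlerH4 (polyY :: (nat, 'k) hopf_str)) (UNIV :: 'k set))"
proof (intro conjI allI impI)
  show "\<exists>(L :: (nat \<times> h4, 'k) hopf_str) g x. is_A_infinity L g x"
    using is_A_infinity_model_1 by blast
  show "\<exists>(act, f) \<in> CS (polyY :: (nat, 'k) hopf_str) sweedlerH4.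
      crossed_product polyY sweedlerH4 act f \<cong>\<^sub>H tensor_hopf polyY sweedlerH4"
    unfolding CS_eq tensor_hopf_eq_model
    by (rule bexI[of _ "(trivial_act, cocycle 0)"])
      (auto simp: crossed_cocycle_eq_model hopf_isomorphic_refl)
  show "Aut_Hopf (tensor_hopf polyY sweedlerH4 :: (nat \<times> h4, 'k) hopf_str) \<cong>
      (field_units :: 'k monoid) \<times>\<times> (field_units :: 'k monoid)"
    unfolding tensor_hopf_eq_model by (rule Aut_model_0)
  show "\<exists>\<Phi>. bij_betw \<Phi> (H2 sweedlerH4 (polyY :: (nat, 'k) hopf_str)) (UNIV :: 'k set)"
    by (rule H2_bij)
next
  fix A_inf :: "('b, 'k) hopf_str" and g x
  assume "is_A_infinity A_inf g x"
  then have iso: "A_inf \<cong>\<^sub>H model 1"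
    using is_A_infinity_model_1 by (rule is_A_infinity_unique)
  then show "\<not> (\<exists>B. finite B \<and> fs.span B = (UNIV :: ('b \<Rightarrow>\<^sub>0 'k) set))"
    by (rule infinite_dimensional)
  show "\<forall>(act, f) \<in> CS polyY sweedlerH4.
      crossed_product polyY sweedlerH4 act f \<cong>\<^sub>H tensor_hopf polyY sweedlerH4 \<or>
      crossed_product polyY sweedlerH4 act f \<cong>\<^sub>H A_inf"
  proof clarify
    fix act f
    assume "(act, f) \<in> CS (polyY :: (nat, 'k) hopf_str) sweedlerH4"
      and ne: "\<not> crossed_product polyY sweedlerH4 act f \<cong>\<^sub>H A_inf"
    then obtain a where a: "act = trivial_act" "f = cocycle a" by (auto simp: CS_eq)
    have "a = 0"
      using ne hopf_isomorphic_trans[OF model_isomorphic_1 hopf_isomorphic_sym[OF iso]]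
      by (auto simp: a crossed_cocycle_eq_model)
    then show "crossed_product polyY sweedlerH4 act f \<cong>\<^sub>H tensor_hopf polyY sweedlerH4"
      by (simp add: a crossed_cocycle_eq_model tensor_hopf_eq_model hopf_isomorphic_refl)
  qed
  show "\<exists>(act, f) \<in> CS polyY sweedlerH4. crossed_product polyY sweedlerH4 act f \<cong>\<^sub>H A_inf"
    unfolding CS_eq
    by (rule bexI[of _ "(trivial_act, cocycle 1)"])
      (auto simp: crossed_cocycle_eq_model hopf_isomorphic_sym[OF iso])
  show "\<not> tensor_hopf polyY sweedlerH4 \<cong>\<^sub>H A_inf"
    unfolding tensor_hopf_eq_model
    using hopf_isomorphic_trans[OF _ iso] model_0_not_isomorphic_1 by blast
  show "Aut_Hopf A_inf \<cong> (field_units :: 'k monoid)"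
    using iso Aut_model_1 by (rule Aut_Hopf_cong)
qed

end
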